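(* Let $s\ge1$, $L\ge1$, widths $d_0=s,\dots,d_{L+1}=N_{\rm obs}$, matrices $W_\ell\in\mathbb{R}^{d_{\ell+1}\times d_\ell}$, vectors $\mathbf{v}_\ell\in\mathbb{R}^{d_{\ell+1}}$ ($\ell=0,\dots,L$), and smooth $\sigma:\mathbb{R}\to\mathbb{R}$ applied componentwise with $\sup_x|\sigma^{(n)}(x)|\le\xi\tau^n n!$ for all $n\ge1$, for some $\xi,\tau>0$. Let $\beta_j:=\max_{1\le p\le d_1}|W_{0,p,j}|$ be bounded as below, $R_\ell$ positive numbers with $\|W_\ell\|_\infty:=\max_p\sum_q|W_{\ell,p,q}|\le R_\ell$ ($\ell\ge1$), $P_0:=1$, $P_k:=\prod_{t=1}^k(\xi\tau R_t)$, $S_L:=\tau\sum_{k=0}^{L-1}P_k$ and $C_L:=\max\{\|G^{[L]}_\theta\|_\infty,P_L/S_L\}$, where $\|G^{[L]}_\theta\|_\infty=\sup_{\mathbf{y}\in[0,1]^s}\max_p|G^{[L]}_\theta(\mathbf{y})_p|$. Let a positive sequence $(b_j)_{j\ge1}$ and a constant $C>0$ be given, and suppose the network parameters are restricted so that: $R_\ell\le\rho$ for all $\ell=1,\dots,L-1$ for some $\rho>0$; $\beta_j\le b_j/S_L$ for all $j=1,\dots,s$ (i.e. $\max_p|W_{0,p,j}|\le b_j/S_L$); and $C_L\le C$. Let positive weights $\gamma_{\mathfrak u}$ ($\mathfrak u\subseteq\{1:s\}$, $\gamma_\emptyset=1$) be given. Then $S_L\le\tau L$ if $\xi\tau\rho=1$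 and $S_L\le\tau\frac{(\xi\tau\rho)^L-1}{\xi\tau\rho-1}$ otherwise, and moreover: (a) If $G:[0,1]^s\to\mathbb{R}^{N_{\rm obs}}$ satisfies $|\partial^{\boldsymbol\nu}G(\mathbf{y})_p|\le C\,|\boldsymbol\nu|!\,\mathbf{b}^{\boldsymbol\nu}$ for all $\boldsymbol\nu\in\mathbb{N}_0^s$, all $\mathbf y$ and all $1\le p\le N_{\rm obs}$, then the non-periodic network ($G^{[0]}_\theta(\mathbf{y})=W_0\mathbf{y}+\mathbf{v}_0$, $G^{[\ell]}_\theta=W_\ell\sigma(G^{[\ell-1]}_\theta)+\mathbf{v}_\ell$) satisfies the same bound, and for all $p$: $$\max\{\|G(\cdot)_p\|^2_{\mathcal{W}_{1,\boldsymbol\gamma}},\|G^{[L]}_\theta(\cdot)_p\|^2_{\mathcal{W}_{1,\boldsymbol\gamma}}\}\le C^2\sum_{\mathfrak u}\frac1{\gamma_{\mathfrak u}}\Big(|\mathfrak u|!\prod_{j\in\mathfrak u}b_j\Big)^2,$$ $$\|(G(\cdot)_p-G^{[L]}_\theta(\cdot)_p)^2\|^2_{\mathcal{W}_{1,\boldsymbol\gamma}}\le16C^4\sum_{\mathfrak u}\frac1{\gamma_{\mathfrak u}}\Big((|\mathfrak u|+1)!\prod_{j\in\mathfrak u}b_j\Big)^2.$$ (b) If $G:[0,1]^s\to\mathbb{R}^{N_{\rm obs}}$ is one-periodic in each variable and satisfies $|\partial^{\boldsymbol\nu}G(\mathbf{y})_p|\le C(2\pi)^{|\boldsymbol\nu|}\sum_{\mathbf{m}\le\boldsymbol\nu}|\mathbf{m}|!\,\mathbf{b}^{\mathbf{m}}\mathcal{S}(\boldsymbol\nu,\mathbf{m})$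 for all $\boldsymbol\nu$, $\mathbf y$, $p$, then the periodic network ($G^{[0]}_\theta(\mathbf{y})=W_0\sin(2\pi\mathbf{y})+\mathbf{v}_0$, $G^{[\ell]}_\theta=W_\ell\sigma(G^{[\ell-1]}_\theta)+\mathbf{v}_\ell$) satisfies the same bound, and for every integer $\alpha\ge1$ and all $p$: $$\max\{\|G(\cdot)_p\|^2_{\mathcal{W}_{\alpha,\boldsymbol\gamma}},\|G^{[L]}_\theta(\cdot)_p\|^2_{\mathcal{W}_{\alpha,\boldsymbol\gamma}}\}\le C^2\sum_{\mathfrak u}\frac{(2\pi)^{2\alpha|\mathfrak u|}}{\gamma_{\mathfrak u}}\Big(\sum_{\mathbf m_{\mathfrak u}\le\boldsymbol\alpha_{\mathfrak u}}|\mathbf m_{\mathfrak u}|!\,\mathcal{S}(\boldsymbol\alpha_{\mathfrak u},\mathbf m_{\mathfrak u})\prod_{j\in\mathfrak u}b_j^{m_j}\Big)^2,$$ $$\|(G(\cdot)_p-G^{[L]}_\theta(\cdot)_p)^2\|^2_{\mathcal{W}_{\alpha,\boldsymbol\gamma}}\le16C^4\sum_{\mathfrak u}\frac{(2\pi)^{2\alpha|\mathfrak u|}}{\gamma_{\mathfrak u}}\Big(\sum_{\mathbf m_{\mathfrak u}\le\boldsymbol\alpha_{\mathfrak u}}(|\mathbf m_{\mathfrak u}|+1)!\,\mathcal{S}(\boldsymbol\alpha_{\mathfrak u},\mathbf m_{\mathfrak u})\prod_{j\in\mathfrak u}b_j^{m_j}\Big)^2.$$ (c) Under the hypotheses of (b),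 for every integer $\alpha\ge2$ and all $p$: $$\max\{\|G(\cdot)_p\|_{\mathcal{K}_{\alpha,\boldsymbol\gamma}},\|G^{[L]}_\theta(\cdot)_p\|_{\mathcal{K}_{\alpha,\boldsymbol\gamma}}\}\le C\max_{\mathfrak u}\frac{(2\pi)^{\alpha|\mathfrak u|}}{\gamma_{\mathfrak u}}\sum_{\mathbf m_{\mathfrak u}\le\boldsymbol\alpha_{\mathfrak u}}|\mathbf m_{\mathfrak u}|!\,\mathcal{S}(\boldsymbol\alpha_{\mathfrak u},\mathbf m_{\mathfrak u})\prod_{j\in\mathfrak u}b_j^{m_j},$$ $$\|(G(\cdot)_p-G^{[L]}_\theta(\cdot)_p)^2\|_{\mathcal{K}_{\alpha,\boldsymbol\gamma}}\le4C^2\max_{\mathfrak u}\frac{(2\pi)^{\alpha|\mathfrak u|}}{\gamma_{\mathfrak u}}\sum_{\mathbf m_{\mathfrak u}\le\boldsymbol\alpha_{\mathfrak u}}(|\mathbf m_{\mathfrak u}|+1)!\,\mathcal{S}(\boldsymbol\alpha_{\mathfrak u},\mathbf m_{\mathfrak u})\prod_{j\in\mathfrak u}b_j^{m_j}.$$ Here sums and maxima over $\mathfrak u$ range over all subsets $\mathfrak u\subseteq\{1,\dots,s\}$.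
   Context: For $\boldsymbol\nu\in\mathbb{N}_0^s$: $|\boldsymbol\nu|=\sum_j\nu_j$, $\partial^{\boldsymbol\nu}=\prod_j(\partial/\partial y_j)^{\nu_j}$, $\mathbf b^{\boldsymbol\nu}=\prod_jb_j^{\nu_j}$, $\le$ is componentwise. $\mathcal{S}(n,k)$ is the Stirling number of the second kind ($\mathcal{S}(n,0)=\delta_{n,0}$, $\mathcal{S}(n,k)=0$ for $k>n$, $\mathcal{S}(n,k)=\frac1{k!}\sum_{i=0}^k(-1)^{k-i}\binom ki i^n$ otherwise), $\mathcal{S}(\boldsymbol\nu,\mathbf m)=\prod_j\mathcal{S}(\nu_j,m_j)$. For $\mathfrak u\subseteq\{1,\dots,s\}$: $\boldsymbol\alpha_{\mathfrak u}=(\alpha,\dots,\alpha)\in\mathbb{N}_0^{\mathfrak u}$, $\mathbf m_{\mathfrak u}\in\mathbb{N}_0^{\mathfrak u}$, $|\mathbf m_{\mathfrak u}|=\sum_{j\in\mathfrak u}m_j$, $\mathcal{S}(\boldsymbol\alpha_{\mathfrak u},\mathbf m_{\mathfrak u})=\prod_{j\in\mathfrak u}\mathcal{S}(\alpha,m_j)$, $\partial^{\boldsymbol\alpha_{\mathfrak u}}=\prod_{j\in\mathfrak u}(\partial/\partial y_j)^\alpha$. For sufficiently smooth $F:[0,1]^s\to\mathbb{R}$, $\|F\|^2_{\mathcal{W}_{\alpha,\boldsymbol\gamma}}:=\sum_{\mathfrak u}\frac1{\gamma_{\mathfrak u}}\int_{[0,1]^{|\mathfrak u|}}\big|\int_{[0,1]^{s-|\mathfrak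 u|}}\partial^{\boldsymbol\alpha_{\mathfrak u}}F(\mathbf y)\,d\mathbf y_{\{1:s\}\setminus\mathfrak u}\big|^2d\mathbf y_{\mathfrak u}$ (for $\alpha=1$ this is the unanchored weighted Sobolev norm). $\|\cdot\|_{\mathcal{K}_{\alpha,\boldsymbol\gamma}}$ is the norm of the non-Hilbert weighted Korobov space of one-periodic functions, which satisfies for every sufficiently smooth one-periodic $F$: $\|F\|_{\mathcal{K}_{\alpha,\boldsymbol\gamma}}\le\max_{\mathfrak u}\frac1{\gamma_{\mathfrak u}}\int_{[0,1]^{|\mathfrak u|}}\big|\int_{[0,1]^{s-|\mathfrak u|}}\partial^{\boldsymbol\alpha_{\mathfrak u}}F(\mathbf y)\,d\mathbf y_{\{1:s\}\setminus\mathfrak u}\big|d\mathbf y_{\mathfrak u}$. *)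

theory Defs
  imports "HOL-Analysis.Analysis" "HOL-Combinatorics.Stirling"
begin

(* Conventions: coordinates of y in [0,1]^s are indexed 0..s-1 (paper: 1..s);
   points are extensional functions nat => real (undefined outside {..<s}). *)

definition cube :: "nat \<Rightarrow> (nat \<Rightarrow> real) set" where
  "cube s = PiE {..<s} (\<lambda>_. {0..1})"

definition real_space :: "nat \<Rightarrow> (nat \<Rightarrow> real) set" where
  "real_space s = PiE {..<s} (\<lambda>_. UNIV)"

(* partial derivative in coordinate j, taken within the interval I (I = {0..1} for
   functions on the cube, I = UNIV for functions on all of R^s) *)
definition dpartial :: "real set \<Rightarrow> nat \<Rightarrow> ((nat \<Rightarrow> real) \<Rightarrow> real) \<Rightarrow> (nat \<Rightarrow> real) \<Rightarrow> real" where
  "dpartial I j F y = vector_derivative (\<lambda>t. F (y(j := t))) (at (y j) within I)"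

definition diter :: "real set \<Rightarrow> nat list \<Rightarrow> ((nat \<Rightarrow> real) \<Rightarrow> real) \<Rightarrow> (nat \<Rightarrow> real) \<Rightarrow> real" where
  "diter I js F = foldr (dpartial I) js F"

definition dlist :: "nat \<Rightarrow> (nat \<Rightarrow> nat) \<Rightarrow> nat list" where
  "dlist s \<nu> = concat (map (\<lambda>j. replicate (\<nu> j) j) [0..<s])"

definition dmulti :: "real set \<Rightarrow> nat \<Rightarrow> (nat \<Rightarrow> nat) \<Rightarrow> ((nat \<Rightarrow> real) \<Rightarrow> real) \<Rightarrow> (nat \<Rightarrow> real) \<Rightarrow> real" where
  "dmulti I s \<nu> F = diter I (dlist s \<nu>) F"

definition smooth_on :: "real set \<Rightarrow> nat \<Rightarrow> ((nat \<Rightarrow> real) \<Rightarrow> real) \<Rightarrow> bool" where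
  "smooth_on I s F \<longleftrightarrow>
     (\<forall>js. set js \<subseteq> {..<s} \<longrightarrow>
       (\<forall>j<s. \<forall>y\<in>PiE {..<s} (\<lambda>_. I).
          ((\<lambda>t. diter I js F (y(j := t))) has_vector_derivative
              dpartial I j (diter I js F) y) (at (y j) within I)))"

definition mabs :: "nat \<Rightarrow> (nat \<Rightarrow> nat) \<Rightarrow> nat" where
  "mabs s \<nu> = (\<Sum>j<s. \<nu> j)"

definition bpow :: "nat \<Rightarrow> (nat \<Rightarrow> real) \<Rightarrow> (nat \<Rightarrow> nat) \<Rightarrow> real" where
  "bpow s b \<nu> = (\<Prod>j<s. b j ^ \<nu> j)"

definition stirling_multi :: "nat \<Rightarrow> (nat \<Rightarrow> nat) \<Rightarrow> (nat \<Rightarrow> nat) \<Rightarrow> real" where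
  "stirling_multi s \<nu> m = (\<Prod>j<s. real (Stirling (\<nu> j) (m j)))"

definition per_bound :: "nat \<Rightarrow> (nat \<Rightarrow> real) \<Rightarrow> (nat \<Rightarrow> nat) \<Rightarrow> real" where
  "per_bound s b \<nu> = (\<Sum>m\<in>PiE {..<s} (\<lambda>j. {0..\<nu> j}).
       fact (mabs s m) * bpow s b m * stirling_multi s \<nu> m)"

definition unitI :: "real measure" where
  "unitI = restrict_space lborel {0..1}"

definition alpha_u :: "nat \<Rightarrow> nat set \<Rightarrow> nat \<Rightarrow> nat" where
  "alpha_u \<alpha> u = (\<lambda>j. if j \<in> u then \<alpha> else 0)"

definition sob_sq :: "nat \<Rightarrow> nat \<Rightarrow> (nat set \<Rightarrow> real) \<Rightarrow> ((nat \<Rightarrow> real) \<Rightarrow> real) \<Rightarrow> real" where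
  "sob_sq s \<alpha> \<gamma> F = (\<Sum>u\<in>Pow {..<s}. (1 / \<gamma> u) *
     (\<integral>yu. (\<integral>yv. dmulti {0..1} s (alpha_u \<alpha> u) F (merge u ({..<s} - u) (yu, yv))
                 \<partial>(PiM ({..<s} - u) (\<lambda>_. unitI))) ^ 2 \<partial>(PiM u (\<lambda>_. unitI))))"

definition fourier_coeff :: "nat \<Rightarrow> ((nat \<Rightarrow> real) \<Rightarrow> real) \<Rightarrow> (nat \<Rightarrow> int) \<Rightarrow> complex" where
  "fourier_coeff s F h = (\<integral>y. complex_of_real (F y) *
       cis (- 2 * pi * (\<Sum>j<s. real_of_int (h j) * y j)) \<partial>(PiM {..<s} (\<lambda>_. unitI)))"

definition supp_int :: "nat \<Rightarrow> (nat \<Rightarrow> int) \<Rightarrow> nat set" where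
  "supp_int s h = {j\<in>{..<s}. h j \<noteq> 0}"

definition r_alpha :: "nat \<Rightarrow> nat \<Rightarrow> (nat set \<Rightarrow> real) \<Rightarrow> (nat \<Rightarrow> int) \<Rightarrow> real" where
  "r_alpha s \<alpha> \<gamma> h = (\<Prod>j\<in>supp_int s h. real_of_int \<bar>h j\<bar> ^ \<alpha>) / \<gamma> (supp_int s h)"

definition korobov_norm :: "nat \<Rightarrow> nat \<Rightarrow> (nat set \<Rightarrow> real) \<Rightarrow> ((nat \<Rightarrow> real) \<Rightarrow> real) \<Rightarrow> real" where
  "korobov_norm s \<alpha> \<gamma> F =
     (SUP h\<in>PiE {..<s} (\<lambda>_. UNIV). cmod (fourier_coeff s F h) * r_alpha s \<alpha> \<gamma> h)"

(* network: layer 0 uses input map inp (identity or sin(2 pi .)) *)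
primrec net :: "(real \<Rightarrow> real) \<Rightarrow> (nat \<Rightarrow> nat \<Rightarrow> nat \<Rightarrow> real) \<Rightarrow> (nat \<Rightarrow> nat \<Rightarrow> real)
                 \<Rightarrow> (nat \<Rightarrow> nat) \<Rightarrow> (real \<Rightarrow> real) \<Rightarrow> nat \<Rightarrow> (nat \<Rightarrow> real) \<Rightarrow> nat \<Rightarrow> real" where
  "net \<sigma> W v d inp 0 y = (\<lambda>p. (\<Sum>j<d 0. W 0 p j * inp (y j)) + v 0 p)"
| "net \<sigma> W v d inp (Suc l) y =
     (\<lambda>p. (\<Sum>q<d (Suc l). W (Suc l) p q * \<sigma> (net \<sigma> W v d inp l y q)) + v (Suc l) p)"

definition mat_inf_norm :: "(nat \<Rightarrow> nat \<Rightarrow> nat \<Rightarrow> real) \<Rightarrow> (nat \<Rightarrow> nat) \<Rightarrow> nat \<Rightarrow> real" where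
  "mat_inf_norm W d l = Max ((\<lambda>p. \<Sum>q<d l. \<bar>W l p q\<bar>) ` {..<d (Suc l)})"

definition beta :: "(nat \<Rightarrow> nat \<Rightarrow> nat \<Rightarrow> real) \<Rightarrow> (nat \<Rightarrow> nat) \<Rightarrow> nat \<Rightarrow> real" where
  "beta W d j = Max ((\<lambda>p. \<bar>W 0 p j\<bar>) ` {..<d 1})"

definition Pk :: "real \<Rightarrow> real \<Rightarrow> (nat \<Rightarrow> real) \<Rightarrow> nat \<Rightarrow> real" where
  "Pk \<xi> \<tau> R k = (\<Prod>t\<in>{1..k}. \<xi> * \<tau> * R t)"

definition SL :: "real \<Rightarrow> real \<Rightarrow> (nat \<Rightarrow> real) \<Rightarrow> nat \<Rightarrow> real" where
  "SL \<xi> \<tau> R L = \<tau> * (\<Sum>k<L. Pk \<xi> \<tau> R k)"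

definition net_sup :: "nat \<Rightarrow> nat \<Rightarrow> ((nat \<Rightarrow> real) \<Rightarrow> nat \<Rightarrow> real) \<Rightarrow> real" where
  "net_sup s N G = (SUP y\<in>cube s. Max ((\<lambda>p. \<bar>G y p\<bar>) ` {..<N}))"

end

theory Submission
  imports Defs "HOL-Probability.Probability" "HOL-Computational_Algebra.Formal_Power_Series"
    "HOL-Library.Sublist"
begin

text \<open>
  Bounds on mixed derivatives are compared with the derivatives at the origin of functions
  \<open>f (\<Sum>j. b\<^sub>j x\<^sub>j)\<close> in the non-periodic case and \<open>f (\<Sum>j. b\<^sub>j (exp (2\<pi> x\<^sub>j) - 1))\<close> in the periodic one,
  where \<open>f\<close> is a univariate power series. Such majorants multiply under the Leibniz rule, and composition
  with \<open>\<sigma>\<close> acts on \<open>f\<close> by composition with \<open>\<xi> \<Sum>n. (\<tau> t)\<^sup>n\<close>. Hence layer \<open>l\<close> of the network is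
  majorised by a series with derivative proportional to \<open>P\<^sub>l / (1 - S\<^sub>l t)\<^sup>2\<close>, which gives
  \<open>C / (1 - t)\<close> after the last layer; the squared error is majorised by \<open>4 C\<^sup>2 / (1 - t)\<^sup>2\<close>.
  The Stirling numbers are the Taylor coefficients of the powers of \<open>exp x - 1\<close>.
  The Sobolev norms are bounded by the suprema of the derivatives, and the Korobov norm by integrating
  the Fourier coefficients by parts.\<close>

section \<open>Iterated partial derivatives\<close>

text \<open>Only derivatives of order at least one can be propagated through the layers:
  \<open>\<sigma>\<close> itself may be unbounded and the shifts \<open>v\<close> are arbitrary.
  Hence the invariant concerns the derivative of the majorant series, and order zero is covered by
  the sup norm contained in C_L. The closed form persists because Moebius maps compose. If g = c P t
  / (1 - c S t), then g' = c P / (1 - c S t)^2 and 1 / (1 - \<tau> g) = (1 - c S t) / (1 - c (S +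
  \<tau> P) t), whose derivative is \<tau> c P / (1 - c (S + \<tau> P) t)^2. So a layer replaces S
  by S + \<tau> P and P by \<xi> \<tau> R P, which is where S_L = \<tau> (P_0 + ... + P_{L-1}) comes
  from; the scale c = 1 / S_L moves the last pole to 1. Derivatives are indexed by ordered lists of
  directions, from which the product and chain rules peel off one entry at a time. This replaces the
  combinatorics of a multivariate Faa di Bruno formula, and since only subsequences of sorted lists
  arise, partial derivatives are never interchanged.\<close>

locale product_domain =
  fixes I :: "real set" and s :: nat
  assumes at_within_nontrivial: "t \<in> I \<Longrightarrow> at t within I \<noteq> bot"
begin

abbreviation dom :: "(nat \<Rightarrow> real) set" where
  "dom \<equiv> PiE {..<s} (\<lambda>_. I)"

text \<open>The head of the list is differentiated first, whereas \<open>diter\<close> applies it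
  last. With this orientation an induction over the list simply replaces \<open>F\<close> by
  \<open>dpartial I j F\<close>.\<close>

definition der :: "nat list \<Rightarrow> ((nat \<Rightarrow> real) \<Rightarrow> real) \<Rightarrow> (nat \<Rightarrow> real) \<Rightarrow> real" where
  "der js F = fold (dpartial I) js F"

lemma der_Nil [simp]: "der [] F = F"
  and der_Cons [simp]: "der (j # js) F = der js (dpartial I j F)"
  by (simp_all add: der_def)

lemma diter_eq_der: "diter I js F = der (rev js) F"
  by (simp add: diter_def der_def foldr_conv_fold)

definition partial_deriv :: "nat \<Rightarrow> ((nat \<Rightarrow> real) \<Rightarrow> real) \<Rightarrow> ((nat \<Rightarrow> real) \<Rightarrow> real) \<Rightarrow> bool" where
  "partial_deriv j F F' \<longleftrightarrow>
    (\<forall>y\<in>dom. ((\<lambda>t. F (y(j := t))) has_real_derivative F' y) (at (y j) within I))"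

text \<open>Counting the available derivatives makes closure under products and compositions an
  induction on \<open>n\<close>: differentiating a product leaves one factor undifferentiated, and
  that factor has one order to spare.\<close>

primrec diff_order :: "nat \<Rightarrow> ((nat \<Rightarrow> real) \<Rightarrow> real) \<Rightarrow> bool" where
  "diff_order 0 F = True"
| "diff_order (Suc n) F =
    (\<forall>j<s. partial_deriv j F (dpartial I j F) \<and> diff_order n (dpartial I j F))"

definition smooth :: "((nat \<Rightarrow> real) \<Rightarrow> real) \<Rightarrow> bool" where
  "smooth F \<longleftrightarrow> (\<forall>n. diff_order n F)"

lemma dom_upd: "y \<in> dom \<Longrightarrow> j < s \<Longrightarrow> t \<in> I \<Longrightarrow> y(j := t) \<in> dom"
  by (auto simp: PiE_iff extensional_def)

lemma dom_nth: "y \<in> dom \<Longrightarrow> j < s \<Longrightarrow> y j \<in> I"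
  by auto

lemma dpartial_eqI:
  assumes "partial_deriv j F F'" "y \<in> dom" "j < s"
  shows "dpartial I j F y = F' y"
proof -
  have "at (y j) within I \<noteq> bot"
    using at_within_nontrivial[OF dom_nth[OF assms(2,3)]] .
  moreover have "((\<lambda>t. F (y(j := t))) has_vector_derivative F' y) (at (y j) within I)"
    using assms(1,2) by (simp add: partial_deriv_def has_real_derivative_iff_has_vector_derivative)
  ultimately show ?thesis
    unfolding dpartial_def by (rule vector_derivative_within)
qed

text \<open>Differentiation rules identify \<open>dpartial\<close> only on \<open>dom\<close>, so
  iterating them requires that functions may be changed off \<open>dom\<close>. This is harmless
  because a coordinate line through a point of \<open>dom\<close>, restricted to \<open>I\<close>,
  stays in \<open>dom\<close>.\<close>

lemma has_vector_derivative_dom_cong: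
  assumes "\<And>y. y \<in> dom \<Longrightarrow> F y = G y" "y \<in> dom" "j < s"
    and "((\<lambda>t. F (y(j := t))) has_vector_derivative c) (at (y j) within I)"
  shows "((\<lambda>t. G (y(j := t))) has_vector_derivative c) (at (y j) within I)"
proof (rule has_vector_derivative_transform[OF dom_nth[OF assms(2,3)] _ assms(4)])
  fix t assume "t \<in> I"
  then show "G (y(j := t)) = F (y(j := t))"
    using assms(1)[OF dom_upd[OF assms(2,3)]] by simp
qed

lemma dpartial_cong:
  assumes "\<And>y. y \<in> dom \<Longrightarrow> F y = G y" "y \<in> dom" "j < s"
  shows "dpartial I j F y = dpartial I j G y"
proof -
  have "((\<lambda>t. F (y(j := t))) has_vector_derivative c) (at (y j) within I) \<longleftrightarrow>
        ((\<lambda>t. G (y(j := t))) has_vector_derivative c) (at (y j) within I)" for c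
    using has_vector_derivative_dom_cong[of F G] has_vector_derivative_dom_cong[of G F] assms
    by metis
  then show ?thesis by (simp add: dpartial_def vector_derivative_def)
qed

lemma partial_deriv_cong:
  assumes "\<And>y. y \<in> dom \<Longrightarrow> F y = G y" "\<And>y. y \<in> dom \<Longrightarrow> F' y = G' y" "j < s"
    and "partial_deriv j F F'"
  shows "partial_deriv j G G'"
  unfolding partial_deriv_def has_real_derivative_iff_has_vector_derivative
proof
  fix y assume y: "y \<in> dom"
  then have "((\<lambda>t. F (y(j := t))) has_vector_derivative F' y) (at (y j) within I)"
    using assms(4) by (simp add: partial_deriv_def has_real_derivative_iff_has_vector_derivative)
  with has_vector_derivative_dom_cong[OF assms(1) y assms(3)] assms(2)[OF y]
  show "((\<lambda>t. G (y(j := t))) has_vector_derivative G' y) (at (y j) within I)" by simp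
qed

lemma der_cong:
  assumes "\<And>y. y \<in> dom \<Longrightarrow> F y = G y" "set js \<subseteq> {..<s}" "y \<in> dom"
  shows "der js F y = der js G y"
  using assms
proof (induction js arbitrary: F G)
  case (Cons j js)
  have "der js (dpartial I j F) y = der js (dpartial I j G) y"
    using Cons.prems by (intro Cons.IH dpartial_cong) auto
  then show ?case by simp
qed auto

lemma diff_order_cong:
  assumes "\<And>y. y \<in> dom \<Longrightarrow> F y = G y" "diff_order n F"
  shows "diff_order n G"
  using assms
proof (induction n arbitrary: F G)
  case (Suc n)
  have "partial_deriv j G (dpartial I j G) \<and> diff_order n (dpartial I j G)" if "j < s" for j
  proof
    have eq: "dpartial I j F y = dpartial I j G y" if "y \<in> dom" for y
      by (rule dpartial_cong[OF Suc.prems(1) that \<open>j < s\<close>])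
    from Suc.prems(2) that have *: "partial_deriv j F (dpartial I j F)" "diff_order n (dpartial I j F)"
      unfolding diff_order.simps by blast+
    show "partial_deriv j G (dpartial I j G)"
      by (rule partial_deriv_cong[OF Suc.prems(1) eq that *(1)])
    show "diff_order n (dpartial I j G)"
      by (rule Suc.IH[OF eq *(2)])
  qed
  then show ?case by simp
qed simp

lemma diff_orderI:
  assumes "\<And>j. j < s \<Longrightarrow> partial_deriv j F (F' j)" "\<And>j. j < s \<Longrightarrow> diff_order n (F' j)"
  shows "diff_order (Suc n) F"
proof -
  have "partial_deriv j F (dpartial I j F) \<and> diff_order n (dpartial I j F)" if "j < s" for j
  proof
    have eq: "F' j y = dpartial I j F y" if "y \<in> dom" for y
      by (rule dpartial_eqI[OF assms(1)[OF \<open>j < s\<close>] that \<open>j < s\<close>, symmetric])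
    show "partial_deriv j F (dpartial I j F)"
      by (rule partial_deriv_cong[OF refl eq that assms(1)[OF that]])
    show "diff_order n (dpartial I j F)"
      by (rule diff_order_cong[OF eq assms(2)[OF that]])
  qed
  then show ?thesis by simp
qed

lemma der_Cons_eq:
  assumes "partial_deriv j F F'" "set (j # js) \<subseteq> {..<s}" "y \<in> dom"
  shows "der (j # js) F y = der js F' y"
  unfolding der_Cons using assms by (intro der_cong dpartial_eqI) auto

lemma diff_order_SucD: "diff_order (Suc n) F \<Longrightarrow> diff_order n F"
proof (induction n arbitrary: F)
  case (Suc n)
  show ?case
  proof (rule diff_orderI)
    fix j assume "j < s"
    then show "partial_deriv j F (dpartial I j F)" using Suc.prems by simp
    show "diff_order n (dpartial I j F)"
      using Suc.IH[of "dpartial I j F"] Suc.prems \<open>j < s\<close> unfolding diff_order.simps(2)[of "Suc n"] by blast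
  qed
qed simp

section \<open>Differentiation rules and closure properties of smooth functions\<close>

lemma partial_deriv_add:
  "partial_deriv j F F' \<Longrightarrow> partial_deriv j G G' \<Longrightarrow>
    partial_deriv j (\<lambda>y. F y + G y) (\<lambda>y. F' y + G' y)"
  unfolding partial_deriv_def by (intro ballI DERIV_add) blast+

lemma partial_deriv_cmult:
  "partial_deriv j F F' \<Longrightarrow> partial_deriv j (\<lambda>y. c * F y) (\<lambda>y. c * F' y)"
  unfolding partial_deriv_def by (intro ballI DERIV_cmult) blast

lemma partial_deriv_mult:
  "partial_deriv j F F' \<Longrightarrow> partial_deriv j G G' \<Longrightarrow>
    partial_deriv j (\<lambda>y. F y * G y) (\<lambda>y. F' y * G y + F y * G' y)"
  unfolding partial_deriv_def
proof (intro ballI)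
  fix y assume "\<forall>y\<in>dom. ((\<lambda>t. F (y(j := t))) has_real_derivative F' y) (at (y j) within I)"
    "\<forall>y\<in>dom. ((\<lambda>t. G (y(j := t))) has_real_derivative G' y) (at (y j) within I)" "y \<in> dom"
  then have "((\<lambda>t. F (y(j := t))) has_real_derivative F' y) (at (y j) within I)"
    "((\<lambda>t. G (y(j := t))) has_real_derivative G' y) (at (y j) within I)" by blast+
  from DERIV_mult[OF this]
  show "((\<lambda>t. F (y(j := t)) * G (y(j := t))) has_real_derivative F' y * G y + F y * G' y)
      (at (y j) within I)" by (simp add: mult.commute)
qed

lemma partial_deriv_const: "partial_deriv j (\<lambda>y. c) (\<lambda>y. 0)"
  unfolding partial_deriv_def by simp

lemma partial_deriv_compose:
  assumes "partial_deriv j F F'" "\<And>x. (h has_real_derivative h' x) (at x)"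
  shows "partial_deriv j (\<lambda>y. h (F y)) (\<lambda>y. h' (F y) * F' y)"
  unfolding partial_deriv_def
proof
  fix y assume "y \<in> dom"
  then have "((\<lambda>t. F (y(j := t))) has_real_derivative F' y) (at (y j) within I)"
    using assms(1) by (simp add: partial_deriv_def)
  from DERIV_chain2[OF assms(2) this]
  show "((\<lambda>t. h (F (y(j := t)))) has_real_derivative h' (F y) * F' y) (at (y j) within I)"
    by simp
qed

lemma diff_order_add:
  "diff_order n F \<Longrightarrow> diff_order n G \<Longrightarrow> diff_order n (\<lambda>y. F y + G y)"
proof (induction n arbitrary: F G)
  case (Suc n)
  show ?case
  proof (rule diff_orderI)
    fix j assume "j < s"
    with Suc.prems have "partial_deriv j F (dpartial I j F)" "diff_order n (dpartial I j F)"
      "partial_deriv j G (dpartial I j G)" "diff_order n (dpartial I j G)"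
      unfolding diff_order.simps by blast+
    then show "partial_deriv j (\<lambda>y. F y + G y) (\<lambda>y. dpartial I j F y + dpartial I j G y)"
      "diff_order n (\<lambda>y. dpartial I j F y + dpartial I j G y)"
      by (simp_all add: partial_deriv_add Suc.IH)
  qed
qed simp

lemma diff_order_cmult: "diff_order n F \<Longrightarrow> diff_order n (\<lambda>y. c * F y)"
proof (induction n arbitrary: F)
  case (Suc n)
  show ?case
  proof (rule diff_orderI)
    fix j assume "j < s"
    with Suc.prems have "partial_deriv j F (dpartial I j F)" "diff_order n (dpartial I j F)"
      unfolding diff_order.simps by blast+
    then show "partial_deriv j (\<lambda>y. c * F y) (\<lambda>y. c * dpartial I j F y)"
      "diff_order n (\<lambda>y. c * dpartial I j F y)"
      by (simp_all add: partial_deriv_cmult Suc.IH)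
  qed
qed simp

lemma diff_order_const: "diff_order n (\<lambda>y. c)"
proof (induction n arbitrary: c)
  case (Suc n)
  show ?case
    by (rule diff_orderI[OF partial_deriv_const Suc.IH])
qed simp

lemma diff_order_mult:
  "diff_order n F \<Longrightarrow> diff_order n G \<Longrightarrow> diff_order n (\<lambda>y. F y * G y)"
proof (induction n arbitrary: F G)
  case (Suc n)
  note FG = diff_order_SucD[OF Suc.prems(1)] diff_order_SucD[OF Suc.prems(2)]
  show ?case
  proof (rule diff_orderI)
    fix j assume "j < s"
    with Suc.prems have *: "partial_deriv j F (dpartial I j F)" "diff_order n (dpartial I j F)"
      "partial_deriv j G (dpartial I j G)" "diff_order n (dpartial I j G)"
      unfolding diff_order.simps by blast+
    show "partial_deriv j (\<lambda>y. F y * G y) (\<lambda>y. dpartial I j F y * G y + F y * dpartial I j G y)"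
      by (rule partial_deriv_mult[OF *(1,3)])
    show "diff_order n (\<lambda>y. dpartial I j F y * G y + F y * dpartial I j G y)"
      by (rule diff_order_add[OF Suc.IH[OF *(2) FG(2)] Suc.IH[OF FG(1) *(4)]])
  qed
qed simp

text \<open>The whole sequence \<open>h\<close> of successive derivatives is carried along, because
  differentiating \<open>h k (F y)\<close> brings in \<open>h (Suc k)\<close>; the induction is
  therefore general in \<open>k\<close>.\<close>

lemma diff_order_compose:
  assumes "\<And>k x. (h k has_real_derivative h (Suc k) x) (at x)" "diff_order n F"
  shows "diff_order n (\<lambda>y. h k (F y))"
  using assms(2)
proof (induction n arbitrary: k)
  case (Suc n)
  show ?case
  proof (rule diff_orderI)
    fix j assume "j < s"
    with Suc.prems have *: "partial_deriv j F (dpartial I j F)" "diff_order n (dpartial I j F)"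
      unfolding diff_order.simps by blast+
    show "partial_deriv j (\<lambda>y. h k (F y)) (\<lambda>y. h (Suc k) (F y) * dpartial I j F y)"
      by (rule partial_deriv_compose[OF *(1) assms(1)])
    show "diff_order n (\<lambda>y. h (Suc k) (F y) * dpartial I j F y)"
      by (rule diff_order_mult[OF Suc.IH[OF diff_order_SucD[OF Suc.prems]] *(2)])
  qed
qed simp

lemma smooth_add: "smooth F \<Longrightarrow> smooth G \<Longrightarrow> smooth (\<lambda>y. F y + G y)"
  and smooth_mult: "smooth F \<Longrightarrow> smooth G \<Longrightarrow> smooth (\<lambda>y. F y * G y)"
  and smooth_cmult: "smooth F \<Longrightarrow> smooth (\<lambda>y. c * F y)"
  and smooth_const: "smooth (\<lambda>y. c)"
  by (simp_all add: smooth_def diff_order_add diff_order_mult diff_order_cmult diff_order_const)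

lemma smooth_compose:
  assumes "\<And>k x. (h k has_real_derivative h (Suc k) x) (at x)" "smooth F"
  shows "smooth (\<lambda>y. h k (F y))"
  using diff_order_compose[of h, OF assms(1)] assms(2) by (simp add: smooth_def)

lemma smooth_sum:
  assumes "finite A" "\<And>i. i \<in> A \<Longrightarrow> smooth (F i)"
  shows "smooth (\<lambda>y. \<Sum>i\<in>A. F i y)"
  using assms by (induction rule: finite_induct) (simp_all add: smooth_const smooth_add)

lemma smooth_coordinate: 
  assumes "i < s" shows "smooth (\<lambda>y. y i)"
proof -
  have "partial_deriv j (\<lambda>y. y i) (\<lambda>y. of_bool (i = j))" for j
    unfolding partial_deriv_def by (cases "i = j") (auto intro!: derivative_eq_intros)
  then have "diff_order (Suc n) (\<lambda>y. y i)" for n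
    by (rule diff_orderI) (rule diff_order_const)
  then have "diff_order n (\<lambda>y. y i)" for n
    by (cases n) auto
  then show ?thesis by (simp add: smooth_def)
qed

lemma smooth_partial_deriv: "smooth F \<Longrightarrow> j < s \<Longrightarrow> partial_deriv j F (dpartial I j F)"
  unfolding smooth_def using diff_order.simps(2)[of 0 F] by blast

lemma smooth_dpartial: "smooth F \<Longrightarrow> j < s \<Longrightarrow> smooth (dpartial I j F)"
  unfolding smooth_def using diff_order.simps(2)[of _ F] by blast

text \<open>\<open>diter\<close> applies the last entry of its list first, so the assumption on
  \<open>F\<close> for the list \<open>js @ [j]\<close> is the assumption on its \<open>j\<close>-th
  partial derivative for \<open>js\<close>.\<close>

lemma smooth_on_imp_smooth:
  assumes "smooth_on I s F"
  shows "smooth F"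
proof -
  have "diff_order n F" for n
    using assms
  proof (induction n arbitrary: F)
    case (Suc n)
    have "partial_deriv j F (dpartial I j F) \<and> diff_order n (dpartial I j F)" if "j < s" for j
    proof
      show "partial_deriv j F (dpartial I j F)"
        using Suc.prems[unfolded smooth_on_def, rule_format, of "[]" j] that
        by (simp add: partial_deriv_def has_real_derivative_iff_has_vector_derivative diter_def)
      show "diff_order n (dpartial I j F)"
      proof (rule Suc.IH, unfold smooth_on_def, intro allI impI ballI)
        fix js i y assume "set js \<subseteq> {..<s}" "i < s" "y \<in> dom"
        then show "((\<lambda>t. diter I js (dpartial I j F) (y(i := t))) has_vector_derivative
            dpartial I i (diter I js (dpartial I j F)) y) (at (y i) within I)"
          using Suc.prems[unfolded smooth_on_def, rule_format, of "js @ [j]" i y] that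
          by (simp add: diter_def)
      qed
    qed
    then show ?case by simp
  qed simp
  then show ?thesis by (simp add: smooth_def)
qed

lemma der_add:
  assumes "smooth F" "smooth G" "set js \<subseteq> {..<s}" "y \<in> dom"
  shows "der js (\<lambda>y. F y + G y) y = der js F y + der js G y"
  using assms
proof (induction js arbitrary: F G)
  case (Cons j js)
  have "der (j # js) (\<lambda>y. F y + G y) y = der js (\<lambda>y. dpartial I j F y + dpartial I j G y) y"
    using Cons.prems by (intro der_Cons_eq partial_deriv_add smooth_partial_deriv) auto
  also have "\<dots> = der js (dpartial I j F) y + der js (dpartial I j G) y"
    using Cons.prems by (intro Cons.IH smooth_dpartial) auto
  finally show ?case by simp
qed simp

lemma der_cmult:
  assumes "smooth F" "set js \<subseteq> {..<s}" "y \<in> dom"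
  shows "der js (\<lambda>y. c * F y) y = c * der js F y"
  using assms
proof (induction js arbitrary: F)
  case (Cons j js)
  have "der (j # js) (\<lambda>y. c * F y) y = der js (\<lambda>y. c * dpartial I j F y) y"
    using Cons.prems by (intro der_Cons_eq partial_deriv_cmult smooth_partial_deriv) auto
  also have "\<dots> = c * der js (dpartial I j F) y"
    using Cons.prems by (intro Cons.IH smooth_dpartial) auto
  finally show ?case by simp
qed simp

lemma der_const:
  assumes "js \<noteq> []" "set js \<subseteq> {..<s}" "y \<in> dom"
  shows "der js (\<lambda>y. c) y = 0"
  using assms
proof (induction js arbitrary: c)
  case (Cons j js)
  then have "der (j # js) (\<lambda>y. c) y = der js (\<lambda>y. 0) y"
    by (intro der_Cons_eq partial_deriv_const) auto
  then show ?case using Cons by (cases "js = []") auto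
qed simp

lemma der_sum:
  assumes "finite A" "\<And>i. i \<in> A \<Longrightarrow> smooth (F i)" "set js \<subseteq> {..<s}" "y \<in> dom"
  shows "der js (\<lambda>y. \<Sum>i\<in>A. F i y) y = (\<Sum>i\<in>A. der js (F i) y)"
  using assms(1,2)
proof (induction rule: finite_induct)
  case empty
  then show ?case using der_const[of js y 0] assms(3,4) by (cases "js = []") auto
next
  case (insert i A)
  then show ?case using assms(3,4) by (simp add: der_add smooth_sum)
qed

end

text \<open>\<open>shuf a b js\<close> is the sum of \<open>a l * b l'\<close> over all splittings of \<open>js\<close> into complementary
  subsequences \<open>l\<close> and \<open>l'\<close>, the shape of the Leibniz rule.\<close>

primrec shuf :: "('a list \<Rightarrow> real) \<Rightarrow> ('a list \<Rightarrow> real) \<Rightarrow> 'a list \<Rightarrow> real" where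
  "shuf a b [] = a [] * b []"
| "shuf a b (j # js) = shuf (\<lambda>l. a (j # l)) b js + shuf a (\<lambda>l. b (j # l)) js"

lemma shuf_linear_left:
  "shuf (\<lambda>l. c * a l + d * a' l) b js = c * shuf a b js + d * shuf a' b js"
  by (induction js arbitrary: a a' b) (simp_all add: algebra_simps)

lemma shuf_linear_right:
  "shuf a (\<lambda>l. c * b l + d * b' l) js = c * shuf a b js + d * shuf a b' js"
  by (induction js arbitrary: a b b') (simp_all add: algebra_simps)

context product_domain
begin

text \<open>Along each branch of the iterated product rule the two factors receive complementary
  subsequences of \<open>js\<close>. Asking for bounds on subsequences only is what allows
  hypotheses that are known just for sorted lists.\<close>

lemma abs_der_mult_le:
  assumes "smooth F" "smooth G" "set js \<subseteq> {..<s}" "y \<in> dom"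
    and "\<And>l. subseq l js \<Longrightarrow> \<bar>der l F y\<bar> \<le> a l"
    and "\<And>l. subseq l js \<Longrightarrow> \<bar>der l G y\<bar> \<le> b l"
  shows "\<bar>der js (\<lambda>y. F y * G y) y\<bar> \<le> shuf a b js"
  using assms
proof (induction js arbitrary: F G a b)
  case Nil
  have "\<bar>F y\<bar> \<le> a []" "\<bar>G y\<bar> \<le> b []" using Nil(5)[of "[]"] Nil(6)[of "[]"] by auto
  then have "\<bar>F y\<bar> * \<bar>G y\<bar> \<le> a [] * b []" by (intro mult_mono) auto
  then show ?case by (simp add: abs_mult)
next
  case (Cons j js)
  have sm: "smooth (\<lambda>y. dpartial I j F y * G y)" "smooth (\<lambda>y. F y * dpartial I j G y)"
    using Cons.prems by (auto intro!: smooth_mult smooth_dpartial)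
  have "der (j # js) (\<lambda>y. F y * G y) y
      = der js (\<lambda>y. dpartial I j F y * G y + F y * dpartial I j G y) y"
    using Cons.prems by (intro der_Cons_eq partial_deriv_mult smooth_partial_deriv) auto
  also have "\<dots> = der js (\<lambda>y. dpartial I j F y * G y) y + der js (\<lambda>y. F y * dpartial I j G y) y"
    using Cons.prems sm by (intro der_add) auto
  finally have eq: "der (j # js) (\<lambda>y. F y * G y) y = \<dots>" .
  have "\<bar>der js (\<lambda>y. dpartial I j F y * G y) y\<bar> \<le> shuf (\<lambda>l. a (j # l)) b js"
  proof (rule Cons.IH)
    fix l assume "subseq l js"
    then have "subseq (j # l) (j # js)" "subseq l (j # js)" by auto
    then show "\<bar>der l (dpartial I j F) y\<bar> \<le> a (j # l)" "\<bar>der l G y\<bar> \<le> b l"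
      using Cons.prems(5)[of "j # l"] Cons.prems(6)[of l] by auto
  qed (use Cons.prems in \<open>auto intro: smooth_dpartial\<close>)
  moreover have "\<bar>der js (\<lambda>y. F y * dpartial I j G y) y\<bar> \<le> shuf a (\<lambda>l. b (j # l)) js"
  proof (rule Cons.IH)
    fix l assume "subseq l js"
    then have "subseq (j # l) (j # js)" "subseq l (j # js)" by auto
    then show "\<bar>der l F y\<bar> \<le> a l" "\<bar>der l (dpartial I j G) y\<bar> \<le> b (j # l)"
      using Cons.prems(6)[of "j # l"] Cons.prems(5)[of l] by auto
  qed (use Cons.prems in \<open>auto intro: smooth_dpartial\<close>)
  ultimately show ?case unfolding eq by simp
qed

end

section \<open>Majorants\<close>

text \<open>For \<open>w \<noteq> 0\<close>, \<open>maj b w js f k\<close> is the iterated derivative in the directions \<open>js\<close> at \<open>x = 0\<close> of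
  \<open>f (\<Sum>j. b\<^sub>j (exp (w x\<^sub>j) - 1) / w) \<cdot> exp (w \<Sum>j. k\<^sub>j x\<^sub>j)\<close>; for \<open>w = 0\<close>, of \<open>f (\<Sum>j. b\<^sub>j x\<^sub>j)\<close>.\<close>

primrec maj :: "(nat \<Rightarrow> real) \<Rightarrow> real \<Rightarrow> nat list \<Rightarrow> real fps \<Rightarrow> (nat \<Rightarrow> nat) \<Rightarrow> real" where
  "maj b w [] f k = fps_nth f 0"
| "maj b w (j # js) f k =
    b j * maj b w js (fps_deriv f) (k(j := Suc (k j))) + w * real (k j) * maj b w js f k"

lemma maj_add: "maj b w js (f + g) k = maj b w js f k + maj b w js g k"
  by (induction js arbitrary: f g k) (simp_all add: algebra_simps)

lemma maj_cmult: "maj b w js (fps_const c * f) k = c * maj b w js f k"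
  by (induction js arbitrary: f k) (simp_all add: distrib_left)

lemma maj_nonneg:
  assumes "\<And>j. b j \<ge> 0" "w \<ge> 0" "\<And>n. fps_nth f n \<ge> 0"
  shows "maj b w js f k \<ge> 0"
  using assms(3)
proof (induction js arbitrary: f k)
  case (Cons j js)
  then show ?case using assms(1,2) by (simp add: fps_deriv_nth)
qed simp

text \<open>The functions behind \<open>maj\<close> multiply by multiplying the series and adding
  the exponents of the exponential factor, and \<open>shuf\<close> is the Leibniz rule for their
  product at 0.\<close>

lemma shuf_maj:
  "shuf (\<lambda>l. maj b w l f k) (\<lambda>l. maj b w l g m) js = maj b w js (f * g) (\<lambda>i. k i + m i)"
proof (induction js arbitrary: f g k m)
  case (Cons j js)
  have "shuf (\<lambda>l. maj b w l f k) (\<lambda>l. maj b w l g m) (j # js)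
      = b j * maj b w js (fps_deriv f * g) (\<lambda>i. (k(j := Suc (k j))) i + m i)
        + w * real (k j) * maj b w js (f * g) (\<lambda>i. k i + m i)
        + (b j * maj b w js (f * fps_deriv g) (\<lambda>i. k i + (m(j := Suc (m j))) i)
        + w * real (m j) * maj b w js (f * g) (\<lambda>i. k i + m i))"
    by (simp only: shuf.simps maj.simps shuf_linear_left shuf_linear_right Cons.IH)
  also have "(\<lambda>i. (k(j := Suc (k j))) i + m i) = (\<lambda>i. k i + m i)(j := Suc (k j + m j))" by auto
  also have "(\<lambda>i. k i + (m(j := Suc (m j))) i) = (\<lambda>i. k i + m i)(j := Suc (k j + m j))" by auto
  finally show ?case
    unfolding maj.simps fps_deriv_mult maj_add of_nat_add by (simp only: algebra_simps)
qed simp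

lemma maj_const:
  "maj b w js (fps_const c) k = c * prod_list (map (\<lambda>j. w * real (k j)) js)"
proof (induction js)
  case (Cons j js)
  have z: "maj b w js 0 k = 0" for k
    using maj_cmult[of b w js 0 0 k] by simp
  show ?case by (simp add: Cons z)
qed simp

text \<open>Substituting \<open>c * x_j\<close> for \<open>x_j\<close> turns the function for
  \<open>b\<close> and \<open>w\<close> into the one for \<open>c * b_j\<close> and
  \<open>c * w\<close>, and each derivative then costs a factor \<open>c\<close>. This reduces the
  periodic majorant to \<open>w = 1\<close>.\<close>

lemma maj_scale: "maj (\<lambda>j. c * b j) (c * w) js f k = c ^ length js * maj b w js f k"
  by (induction js arbitrary: f k) (simp_all add: algebra_simps)

lemma fact_nth_deriv: "fact n * fps_nth (fps_deriv f) n = (fact (Suc n) * fps_nth f (Suc n) :: real)"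
  by (simp add: fps_deriv_nth algebra_simps)

lemma maj_0: "maj b 0 js f k = prod_list (map b js) * (fact (length js) * fps_nth f (length js))"
proof (induction js arbitrary: f k)
  case (Cons j js)
  then show ?case using fact_nth_deriv[of "length js" f] by simp
qed simp

lemma fact_nth_deriv_iter:
  "fact n * fps_nth ((fps_deriv ^^ i) f) n = (fact (n + i) * fps_nth f (n + i) :: real)"
proof (induction i arbitrary: n)
  case (Suc i)
  have "fact n * fps_nth ((fps_deriv ^^ Suc i) f) n
      = fact (Suc n) * fps_nth ((fps_deriv ^^ i) f) (Suc n)"
    using fact_nth_deriv[of n "(fps_deriv ^^ i) f"] by simp
  also have "\<dots> = fact (n + Suc i) * fps_nth f (n + Suc i)"
    using Suc[of "Suc n"] by (simp del: fact_Suc)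
  finally show ?case .
qed simp

text \<open>Here \<open>i\<close> counts the derivatives in \<open>x_j\<close> that fall on the
  series. Each of them leaves a factor \<open>exp x_j\<close> behind, and a derivative that falls on
  \<open>exp (i * x_j)\<close> instead produces the factor \<open>i\<close>: this is the recurrence
  of the Stirling numbers of the second kind.\<close>

lemma maj_replicate:
  assumes "k j = 0"
  shows "maj b 1 (replicate n j @ js) f k
      = (\<Sum>i\<le>n. real (Stirling n i) * b j ^ i * maj b 1 js ((fps_deriv ^^ i) f) (k(j := i)))"
proof (induction n arbitrary: js)
  case 0
  show ?case using assms by (simp add: fun_upd_idem)
next
  case (Suc n)
  let ?M = "\<lambda>i. maj b 1 js ((fps_deriv ^^ i) f) (k(j := i))"
  \<comment> \<open>The additional direction is moved next to \<open>js\<close>, so that the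
    induction hypothesis, which is general in \<open>js\<close>, takes care of the first
    \<open>n\<close>.\<close>
  have "maj b 1 (replicate (Suc n) j @ js) f k = maj b 1 (replicate n j @ (j # js)) f k"
    by (simp add: replicate_append_same[symmetric])
  also have "\<dots> = (\<Sum>i\<le>n. real (Stirling n i) * b j ^ i * (b j * ?M (Suc i) + real i * ?M i))"
    by (subst Suc) simp
  also have "\<dots> = (\<Sum>i\<le>n. real (Stirling n i) * b j ^ Suc i * ?M (Suc i))
      + (\<Sum>i\<le>n. real i * real (Stirling n i) * b j ^ i * ?M i)"
    by (simp add: sum.distrib algebra_simps)
  \<comment> \<open>The new top term is zero because \<open>Stirling n (Suc n) = 0\<close>; the
    subsequent index shift loses nothing because the factor \<open>i\<close> kills the bottom
    term.\<close>
  also have "(\<Sum>i\<le>n. real i * real (Stirling n i) * b j ^ i * ?M i)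
      = (\<Sum>i\<le>Suc n. real i * real (Stirling n i) * b j ^ i * ?M i)"
    by simp
  also have "\<dots> = (\<Sum>i\<le>n. real (Suc i) * real (Stirling n (Suc i)) * b j ^ Suc i * ?M (Suc i))"
    by (subst sum.atMost_Suc_shift) simp
  also have "(\<Sum>i\<le>n. real (Stirling n i) * b j ^ Suc i * ?M (Suc i)) + \<dots>
      = (\<Sum>i\<le>n. real (Stirling (Suc n) (Suc i)) * b j ^ Suc i * ?M (Suc i))"
    by (simp add: sum.distrib[symmetric] algebra_simps)
  also have "\<dots> = (\<Sum>i\<le>Suc n. real (Stirling (Suc n) i) * b j ^ i * ?M i)"
    by (subst sum.atMost_Suc_shift) simp
  finally show ?case .
qed

lemma sum_PiE_insert:
  assumes "j \<notin> A" "finite A"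
  shows "(\<Sum>m\<in>PiE (insert j A) B. h m) = (\<Sum>i\<in>B j. \<Sum>m\<in>PiE A B. h (m(j := i)))"
proof -
  have "(\<Sum>m\<in>PiE (insert j A) B. h m) = (\<Sum>x\<in>B j \<times> PiE A B. h ((\<lambda>(i, m). m(j := i)) x))"
    unfolding PiE_insert_eq
    by (rule sum.reindex[unfolded comp_def, OF inj_combinator[OF assms(1)]])
  also have "\<dots> = (\<Sum>i\<in>B j. \<Sum>m\<in>PiE A B. h (m(j := i)))"
    by (simp add: sum.cartesian_product case_prod_unfold)
  finally show ?thesis .
qed

text \<open>The variables are used up one block at a time. After the block of \<open>j\<close> the
  series has been differentiated \<open>i\<close> times, and the exponent \<open>k j = i\<close> is
  never met again since \<open>us\<close> is distinct. The choices of \<open>i\<close> for all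
  blocks make up the index \<open>m\<close>.\<close>

lemma maj_Stirling:
  assumes "distinct us" "\<And>j. j \<in> set us \<Longrightarrow> k j = 0"
  shows "maj b 1 (concat (map (\<lambda>j. replicate (\<nu> j) j) us)) f k
      = (\<Sum>m\<in>PiE (set us) (\<lambda>j. {0..\<nu> j}). (\<Prod>j\<in>set us. real (Stirling (\<nu> j) (m j)))
          * (\<Prod>j\<in>set us. b j ^ m j) * (fact (\<Sum>j\<in>set us. m j) * fps_nth f (\<Sum>j\<in>set us. m j)))"
  using assms
proof (induction us arbitrary: k f)
  case (Cons j us)
  let ?U = "set us"
  let ?s = "\<lambda>m. (\<Prod>j\<in>?U. real (Stirling (\<nu> j) (m j))) * (\<Prod>j\<in>?U. b j ^ m j)"
  have jU: "j \<notin> ?U" using Cons.prems by simp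
  have upd: "(\<Sum>l\<in>set (j # us). (m(j := i)) l) = sum m ?U + i"
    "(\<Prod>l\<in>set (j # us). real (Stirling (\<nu> l) ((m(j := i)) l)))
      = real (Stirling (\<nu> j) i) * (\<Prod>l\<in>?U. real (Stirling (\<nu> l) (m l)))"
    "(\<Prod>l\<in>set (j # us). b l ^ (m(j := i)) l) = b j ^ i * (\<Prod>l\<in>?U. b l ^ m l)" for m i
  proof -
    have *: "(m(j := i)) l = m l" if "l \<in> ?U" for l using that jU by auto
    have "(\<Sum>l\<in>?U. (m(j := i)) l) = sum m ?U"
      "(\<Prod>l\<in>?U. real (Stirling (\<nu> l) ((m(j := i)) l))) = (\<Prod>l\<in>?U. real (Stirling (\<nu> l) (m l)))"
      "(\<Prod>l\<in>?U. b l ^ (m(j := i)) l) = (\<Prod>l\<in>?U. b l ^ m l)"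
      by (auto simp only: * intro!: sum.cong prod.cong)
    then show "(\<Sum>l\<in>set (j # us). (m(j := i)) l) = sum m ?U + i"
    "(\<Prod>l\<in>set (j # us). real (Stirling (\<nu> l) ((m(j := i)) l)))
      = real (Stirling (\<nu> j) i) * (\<Prod>l\<in>?U. real (Stirling (\<nu> l) (m l)))"
    "(\<Prod>l\<in>set (j # us). b l ^ (m(j := i)) l) = b j ^ i * (\<Prod>l\<in>?U. b l ^ m l)"
      unfolding list.set(2) sum.insert[OF finite_set jU] prod.insert[OF finite_set jU] fun_upd_same
      by simp_all
  qed
  have IH: "maj b 1 (concat (map (\<lambda>j. replicate (\<nu> j) j) us)) ((fps_deriv ^^ i) f) (k(j := i))
      = (\<Sum>m\<in>PiE ?U (\<lambda>j. {0..\<nu> j}). ?s m * (fact (sum m ?U + i) * fps_nth f (sum m ?U + i)))" for i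
    using Cons.prems jU by (subst Cons.IH) (auto simp: fact_nth_deriv_iter)
  have "maj b 1 (concat (map (\<lambda>j. replicate (\<nu> j) j) (j # us))) f k
      = (\<Sum>i\<in>{0..\<nu> j}. \<Sum>m\<in>PiE ?U (\<lambda>j. {0..\<nu> j}). real (Stirling (\<nu> j) i) * b j ^ i *
          (?s m * (fact (sum m ?U + i) * fps_nth f (sum m ?U + i))))"
    using Cons.prems maj_replicate[of k j b "\<nu> j" "concat (map (\<lambda>j. replicate (\<nu> j) j) us)" f]
    by (simp add: IH sum_distrib_left atMost_atLeast0)
  also have "\<dots> = (\<Sum>i\<in>{0..\<nu> j}. \<Sum>m\<in>PiE ?U (\<lambda>j. {0..\<nu> j}).
      (\<lambda>m. (\<Prod>j\<in>set (j # us). real (Stirling (\<nu> j) (m j)))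
          * (\<Prod>j\<in>set (j # us). b j ^ m j)
          * (fact (\<Sum>j\<in>set (j # us). m j) * fps_nth f (\<Sum>j\<in>set (j # us). m j))) (m(j := i)))"
    by (intro sum.cong refl) (simp only: upd mult_ac)
  also have "\<dots> = (\<Sum>m\<in>PiE (set (j # us)) (\<lambda>j. {0..\<nu> j}). (\<Prod>j\<in>set (j # us). real (Stirling (\<nu> j) (m j)))
          * (\<Prod>j\<in>set (j # us). b j ^ m j) * (fact (\<Sum>j\<in>set (j # us). m j) * fps_nth f (\<Sum>j\<in>set (j # us). m j)))"
    by (simp only: list.set(2) sum_PiE_insert[OF jU finite_set])
  finally show ?case .
qed simp

section \<open>The geometric series 1 / (1 - a t) and quotients of such series\<close>

definition geo :: "real \<Rightarrow> real fps" where
  "geo a = Abs_fps (\<lambda>n. a ^ n)"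

lemma geo_nth [simp]: "fps_nth (geo a) n = a ^ n"
  by (simp add: geo_def)

lemma geo_power_nonneg: "a \<ge> 0 \<Longrightarrow> fps_nth (geo a ^ n) k \<ge> 0"
proof (induction n arbitrary: k)
  case (Suc n)
  then show ?case by (auto simp: fps_mult_nth intro!: sum_nonneg)
qed simp

lemma geo_mult: "geo a = 1 + fps_const a * fps_X * geo a"
proof (rule fps_ext)
  fix n show "fps_nth (geo a) n = fps_nth (1 + fps_const a * fps_X * geo a) n"
    by (cases n) (simp_all add: mult.assoc)
qed

lemma geo_inverse: "(1 - fps_const a * fps_X) * geo a = 1"
  using geo_mult[of a] by (simp add: algebra_simps)

text \<open>Differentiating the identity \<open>geo_inverse\<close> and multiplying by
  \<open>geo a\<close> avoids any comparison of coefficients.\<close>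

lemma geo_deriv: "fps_deriv (geo a) = fps_const a * geo a ^ 2"
proof -
  have "fps_deriv ((1 - fps_const a * fps_X) * geo a) = 0" unfolding geo_inverse by simp
  then have *: "(1 - fps_const a * fps_X) * fps_deriv (geo a) = fps_const a * geo a"
    by (simp add: algebra_simps)
  have "fps_deriv (geo a) = ((1 - fps_const a * fps_X) * geo a) * fps_deriv (geo a)"
    unfolding geo_inverse by simp
  also have "\<dots> = geo a * ((1 - fps_const a * fps_X) * fps_deriv (geo a))"
    by (simp only: mult_ac)
  finally show ?thesis unfolding * by (simp add: power2_eq_square mult_ac)
qed

lemma geo_square_nth: "fps_nth (geo 1 ^ 2) n = real n + 1"
proof -
  have "geo 1 ^ 2 = fps_deriv (geo 1)" by (simp add: geo_deriv)
  then show ?thesis by (simp only: fps_deriv_nth geo_nth) simp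
qed

text \<open>\<open>Q\<close> is the Moebius quotient (1 - a t) / (1 - A t). The first two equations
  combine to \<open>fps_deriv Q = fps_const (A - a) * geo a ^ 2 * Q ^ 2\<close>, the differential
  equation satisfied by 1 / (1 - \<tau> g) when \<tau> g' = (A - a) / (1 - a t)^2.\<close>

lemma geo_quotient_deriv:
  assumes "Q = geo A * (1 - fps_const a * fps_X)"
  shows "fps_deriv Q = fps_const (A - a) * geo A ^ 2"
    and "geo a ^ 2 * Q ^ 2 = geo A ^ 2" and "fps_nth Q 0 = 1"
proof -
  have "geo A = ((1 - fps_const A * fps_X) * geo A) * geo A"
    unfolding geo_inverse by simp
  then have gA: "geo A = geo A ^ 2 * (1 - fps_const A * fps_X)"
    by (simp only: power2_eq_square mult_ac)
  have "fps_deriv Q = fps_const A * geo A ^ 2 * (1 - fps_const a * fps_X) - fps_const a * geo A"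
    by (simp add: assms geo_deriv algebra_simps)
  also have "\<dots> = geo A ^ 2 * (fps_const A * (1 - fps_const a * fps_X) - fps_const a * (1 - fps_const A * fps_X))"
  proof -
    have "fps_const A * geo A ^ 2 * (1 - fps_const a * fps_X) - fps_const a * geo A
        = fps_const A * geo A ^ 2 * (1 - fps_const a * fps_X)
          - fps_const a * (geo A ^ 2 * (1 - fps_const A * fps_X))"
      unfolding gA[symmetric] by simp
    then show ?thesis by (simp only: right_diff_distrib left_diff_distrib mult_ac)
  qed
  also have "\<dots> = fps_const (A - a) * geo A ^ 2"
  proof -
    have "fps_const A * geo A ^ 2 = fps_const a * geo A ^ 2 + fps_const (A - a) * geo A ^ 2"
      by (simp only: distrib_right[symmetric] fps_const_add) simp
    then show ?thesis by (simp add: algebra_simps)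
  qed
  finally show "fps_deriv Q = fps_const (A - a) * geo A ^ 2" .
  have "geo a ^ 2 * Q ^ 2 = ((1 - fps_const a * fps_X) * geo a) ^ 2 * geo A ^ 2"
    unfolding assms by (simp only: power_mult_distrib mult_ac)
  then show "geo a ^ 2 * Q ^ 2 = geo A ^ 2" by (simp only: geo_inverse) simp
  show "fps_nth Q 0 = 1" by (simp add: assms)
qed

section \<open>The chain rule for majorants\<close>

context product_domain
begin

text \<open>All derivatives \<open>h k\<close> are treated at once: one derivative turns
  \<open>h k (g y)\<close> into \<open>h (Suc k) (g y)\<close> times a derivative of
  \<open>g\<close>, and the majorants obey the same rule. The series \<open>\<psi>\<close> stands
  for the derivative of a majorant of \<open>g\<close>, and \<open>Q\<close> for 1 / (1 - \<tau> g).
  The value of \<open>g\<close> never enters, as the bounds on \<open>h k\<close> are uniform in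
  \<open>x\<close>; the undifferentiated \<open>h 0\<close> has no such bound, whence the condition
  \<open>k \<ge> 1 \<or> js \<noteq> []\<close>.\<close>

lemma abs_der_compose_le:
  assumes h: "\<And>k x. (h k has_real_derivative h (Suc k) x) (at x)"
    and hb: "\<And>k x. k \<ge> 1 \<Longrightarrow> \<bar>h k x\<bar> \<le> \<xi> * \<tau> ^ k * fact k"
    and g: "smooth g" and y: "y \<in> dom"
    and gb: "\<And>j js. set (j # js) \<subseteq> {..<s} \<Longrightarrow> \<bar>der (j # js) g y\<bar> \<le> b j * maj b w js \<psi> ((\<lambda>_. 0)(j := Suc 0))"
    and Q: "fps_deriv Q = fps_const \<tau> * \<psi> * Q ^ 2" "fps_nth Q 0 = 1"
    and js: "set js \<subseteq> {..<s}" "k \<ge> 1 \<or> js \<noteq> []"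
  shows "\<bar>der js (\<lambda>y. h k (g y)) y\<bar> \<le> maj b w js (fps_const (\<xi> * \<tau> ^ k * fact k) * Q ^ Suc k) (\<lambda>_. 0)"
  using js
proof (induction js arbitrary: k rule: length_induct)
  case (1 js)
  \<comment> \<open>This is the \<open>k\<close>-th derivative of \<xi> / (1 - \<tau> x), written
    with \<open>Q\<close> for 1 / (1 - \<tau> x).\<close>
  define f where "f k = fps_const (\<xi> * \<tau> ^ k * fact k) * Q ^ Suc k" for k
  have f_deriv: "fps_deriv (f k) = f (Suc k) * \<psi>" for k
  proof -
    have c: "fps_const (\<xi> * \<tau> ^ Suc k * fact (Suc k))
        = fps_const (\<xi> * \<tau> ^ k * fact k) * fps_const (real (Suc k)) * fps_const \<tau>"
      by (simp only: fps_const_mult) (simp add: algebra_simps)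
    have "fps_deriv (f k) = fps_const (\<xi> * \<tau> ^ k * fact k)
        * (fps_const (real (Suc k)) * (fps_const \<tau> * \<psi> * Q ^ 2) * Q ^ k)"
      unfolding f_def fps_deriv_mult fps_deriv_power Q(1) fps_deriv_const by simp
    also have "\<dots> = f (Suc k) * \<psi>"
      unfolding f_def unfolding c unfolding power_Suc power2_eq_square by (simp only: mult_ac)
    finally show ?thesis .
  qed
  show ?case
  proof (cases js)
    case Nil
    then show ?thesis using 1 hb[of k "g y"] Q(2) by (simp add: fps_power_zeroth)
  next
    case (Cons j ls)
    have j: "j < s" and ls: "set ls \<subseteq> {..<s}" using 1(2) Cons by auto
    have "der js (\<lambda>y. h k (g y)) y = der ls (\<lambda>y. h (Suc k) (g y) * dpartial I j g y) y"
      unfolding Cons using j ls y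
      by (intro der_Cons_eq partial_deriv_compose[OF smooth_partial_deriv[OF g j] h]) auto
    \<comment> \<open>The vacuous summand with coefficient 0 brings the second argument into the
      two-term form of \<open>shuf_linear_right\<close>.\<close>
    also have "\<bar>\<dots>\<bar> \<le> shuf (\<lambda>l. maj b w l (f (Suc k)) (\<lambda>_. 0))
        (\<lambda>l. b j * maj b w l (\<psi>) ((\<lambda>_. 0)(j := Suc 0)) + 0 * maj b w l 0 (\<lambda>_. 0)) ls"
    proof (rule abs_der_mult_le)
      show "smooth (\<lambda>y. h (Suc k) (g y))" using smooth_compose[of h, OF h g] .
      show "smooth (dpartial I j g)" using smooth_dpartial[OF g j] .
      fix l assume l: "subseq l ls"
      have "set l \<subseteq> set ls" using list_emb_set[OF l] by blast
      then have sl: "set l \<subseteq> {..<s}" using ls by (rule subset_trans)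
      have len: "length l < length js" using list_emb_length[OF l] Cons by simp
      show "\<bar>der l (\<lambda>y. h (Suc k) (g y)) y\<bar> \<le> maj b w l (f (Suc k)) (\<lambda>_. 0)"
        using 1(1)[rule_format, OF len sl, of "Suc k"] by (simp add: f_def del: power_Suc fact_Suc)
      show "\<bar>der l (dpartial I j g) y\<bar>
          \<le> b j * maj b w l (\<psi>) ((\<lambda>_. 0)(j := Suc 0)) + 0 * maj b w l 0 (\<lambda>_. 0)"
        using gb[of j l] sl j by simp
    qed (use ls y in auto)
    also have "\<dots> = b j * maj b w ls (f (Suc k) * \<psi>) ((\<lambda>_. 0)(j := Suc 0))"
      by (simp only: shuf_linear_right shuf_maj) (simp add: fun_upd_def)
    also have "\<dots> = maj b w js (f k) (\<lambda>_. 0)"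
      by (simp add: Cons f_deriv)
    finally show ?thesis by (simp add: f_def)
  qed
qed

end

section \<open>Derivatives of the network\<close>

context product_domain
begin

lemma der_affine:
  assumes "finite A" "\<And>q. q \<in> A \<Longrightarrow> smooth (F q)" "set js \<subseteq> {..<s}" "y \<in> dom" "js \<noteq> []"
  shows "der js (\<lambda>y. (\<Sum>q\<in>A. a q * F q y) + e) y = (\<Sum>q\<in>A. a q * der js (F q) y)"
proof -
  have "der js (\<lambda>y. (\<Sum>q\<in>A. a q * F q y) + e) y
      = der js (\<lambda>y. \<Sum>q\<in>A. a q * F q y) y + der js (\<lambda>y. e) y"
    using assms by (intro der_add smooth_sum smooth_cmult smooth_const) auto
  also have "\<dots> = (\<Sum>q\<in>A. der js (\<lambda>y. a q * F q y) y)"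
    using assms by (subst der_sum) (auto intro: smooth_cmult simp: der_const)
  also have "\<dots> = (\<Sum>q\<in>A. a q * der js (F q) y)"
    using assms by (intro sum.cong refl der_cmult) auto
  finally show ?thesis .
qed

lemma partial_deriv_coordinate:
  assumes "\<And>n x. (u n has_real_derivative u (Suc n) x) (at x)"
  shows "partial_deriv j (\<lambda>y. u n (y i)) (\<lambda>y. if j = i then u (Suc n) (y i) else 0)"
proof (cases "j = i")
  case True
  then show ?thesis
    unfolding partial_deriv_def using assms[of n] by (auto intro: has_field_derivative_at_within)
next
  case False
  then show ?thesis unfolding partial_deriv_def by simp
qed

lemma der_coordinate:
  assumes u: "\<And>n x. (u n has_real_derivative u (Suc n) x) (at x)"
    and "set js \<subseteq> {..<s}" "y \<in> dom"
  shows "der js (\<lambda>y. u n (y i)) y = (if set js \<subseteq> {i} then u (n + length js) (y i) else 0)"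
  using assms(2)
proof (induction js arbitrary: n)
  case (Cons j js)
  have "der (j # js) (\<lambda>y. u n (y i)) y = der js (\<lambda>y. if j = i then u (Suc n) (y i) else 0) y"
    by (rule der_Cons_eq[OF partial_deriv_coordinate[of u, OF u] Cons.prems assms(3)])
  also have "\<dots> = (if set (j # js) \<subseteq> {i} then u (n + length (j # js)) (y i) else 0)"
  proof (cases "j = i")
    case True
    then show ?thesis using Cons by simp
  next
    case False
    then show ?thesis using der_const[of js y 0] Cons.prems assms(3) by (cases "js = []") auto
  qed
  finally show ?case .
qed simp

end

text \<open>By \<open>maj_const\<close> these are the derivatives of \<open>exp (w * x_j)\<close> at
  0. They vanish for the same lists as those of a function of the single coordinate
  \<open>j\<close>.\<close>

lemma prod_list_indicator:
  "prod_list (map (\<lambda>i. w * real (((\<lambda>_. 0)(j := Suc 0)) i)) js)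
    = (if set js \<subseteq> {j} then w ^ length js else 0)"
  by (induction js) auto

text \<open>One locale serves both networks: \<open>h\<close> and \<open>u\<close> are the
  derivative sequences of the activation and of the input map. The identity satisfies the bound on
  \<open>u\<close> with \<open>\<omega> = 1\<close>, \<open>w = 0\<close>, and the sine with
  \<open>\<omega> = w = 2 * pi\<close>. The scale \<open>c\<close> will be 1 / S_L.\<close>

locale bounded_network = product_domain I s for I :: "real set" and s :: nat +
  fixes \<sigma> inp :: "real \<Rightarrow> real" and h u :: "nat \<Rightarrow> real \<Rightarrow> real"
    and W :: "nat \<Rightarrow> nat \<Rightarrow> nat \<Rightarrow> real" and v :: "nat \<Rightarrow> nat \<Rightarrow> real" and d :: "nat \<Rightarrow> nat"
    and \<xi> \<tau> c \<omega> w :: real and R b :: "nat \<Rightarrow> real" and L :: nat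
  assumes d0: "d 0 = s"
    and h0: "h 0 = \<sigma>" and h_deriv: "\<And>n x. (h n has_real_derivative h (Suc n) x) (at x)"
    and h_bound: "\<And>n x. n \<ge> 1 \<Longrightarrow> \<bar>h n x\<bar> \<le> \<xi> * \<tau> ^ n * fact n"
    and u0: "u 0 = inp" and u_deriv: "\<And>n x. (u n has_real_derivative u (Suc n) x) (at x)"
    and u_bound: "\<And>n x. \<bar>u (Suc n) x\<bar> \<le> \<omega> * w ^ n"
    and pos: "\<xi> > 0" "\<tau> > 0" "c > 0" "\<omega> > 0" "w \<ge> 0" "\<And>j. b j > 0"
    and R_pos: "\<And>l. 1 \<le> l \<Longrightarrow> l \<le> L \<Longrightarrow> R l > 0"
    and W0: "\<And>p j. p < d 1 \<Longrightarrow> j < s \<Longrightarrow> \<bar>W 0 p j\<bar> \<le> c * b j"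
    and W_norm: "\<And>l p. 1 \<le> l \<Longrightarrow> l \<le> L \<Longrightarrow> p < d (Suc l) \<Longrightarrow> (\<Sum>q<d l. \<bar>W l p q\<bar>) \<le> R l"
begin

abbreviation N :: "nat \<Rightarrow> nat \<Rightarrow> (nat \<Rightarrow> real) \<Rightarrow> real" where
  "N l p \<equiv> (\<lambda>y. net \<sigma> W v d inp l y p)"

abbreviation P :: "nat \<Rightarrow> real" where "P \<equiv> Pk \<xi> \<tau> R"

abbreviation S :: "nat \<Rightarrow> real" where "S \<equiv> SL \<xi> \<tau> R"

abbreviation M :: "nat list \<Rightarrow> real fps \<Rightarrow> (nat \<Rightarrow> nat) \<Rightarrow> real" where
  "M \<equiv> maj (\<lambda>j. \<omega> * b j) w"

lemma smooth_input: "i < s \<Longrightarrow> smooth (\<lambda>y. inp (y i))"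
  using smooth_compose[of u, OF u_deriv smooth_coordinate, of i 0] by (simp add: u0)

lemma smooth_net: "smooth (N l p)"
proof (induction l arbitrary: p)
  case 0
  show ?case unfolding net.simps
    by (intro smooth_add smooth_const smooth_sum smooth_cmult smooth_input) (auto simp: d0)
next
  case (Suc l)
  have "smooth (\<lambda>y. \<sigma> (N l q y))" for q
    using smooth_compose[of h, OF h_deriv Suc, of 0 q] by (simp add: h0)
  then show ?case unfolding net.simps
    by (intro smooth_add smooth_const smooth_sum smooth_cmult) auto
qed

text \<open>The input layer is a sum of functions of one coordinate each, so only lists repeating
  \<open>j\<close> contribute. The derivative of its majorant series is the constant
  \<open>c\<close>; the remaining growth in the direction \<open>j\<close> is that of the factor
  \<open>exp (w * x_j)\<close>.\<close>

lemma abs_der_input_layer_le: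
  assumes "p < d 1" "set (j # js) \<subseteq> {..<s}" "y \<in> dom"
  shows "\<bar>der (j # js) (N 0 p) y\<bar> \<le> \<omega> * b j * M js (fps_const c) ((\<lambda>_. 0)(j := Suc 0))"
proof -
  have "der (j # js) (N 0 p) y = (\<Sum>i<s. W 0 p i * der (j # js) (\<lambda>y. inp (y i)) y)"
    unfolding net.simps d0 using assms
    by (subst der_affine) (auto intro: smooth_input)
  also have "\<dots> = (\<Sum>i<s. if i = j then W 0 p j * (if set js \<subseteq> {j} then u (Suc (length js)) (y j) else 0) else 0)"
  proof (rule sum.cong[OF refl])
    fix i
    show "W 0 p i * der (j # js) (\<lambda>y. inp (y i)) y
        = (if i = j then W 0 p j * (if set js \<subseteq> {j} then u (Suc (length js)) (y j) else 0) else 0)"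
      using der_coordinate[of u, OF u_deriv assms(2,3), of 0 i] by (auto simp: u0 simp del: der_Cons)
  qed
  also have "\<dots> = W 0 p j * (if set js \<subseteq> {j} then u (Suc (length js)) (y j) else 0)"
    using assms(2) by (subst sum.delta) auto
  also have "\<bar>\<dots>\<bar> \<le> (c * b j) * (if set js \<subseteq> {j} then \<omega> * w ^ length js else 0)"
    unfolding abs_mult
    using W0[of p j] assms u_bound pos(4,5) by (intro mult_mono) auto
  also have "\<dots> = \<omega> * b j * M js (fps_const c) ((\<lambda>_. 0)(j := Suc 0))"
    unfolding maj_const prod_list_indicator by simp
  finally show ?thesis .
qed

lemma P_pos: "l \<le> L \<Longrightarrow> P l > 0"
  unfolding Pk_def using pos R_pos by (intro prod_pos) auto

lemma P_Suc: "P (Suc l) = P l * (\<xi> * \<tau> * R (Suc l))"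
  by (simp add: Pk_def)

lemma S_Suc: "S (Suc l) = S l + \<tau> * P l"
  by (simp add: SL_def algebra_simps)

lemma S_nonneg: "l \<le> Suc L \<Longrightarrow> S l \<ge> 0"
  unfolding SL_def using pos P_pos by (intro mult_nonneg_nonneg sum_nonneg) (auto intro!: less_imp_le)

lemma M_nonneg: "(\<And>n. fps_nth f n \<ge> 0) \<Longrightarrow> M js f k \<ge> 0"
  using pos by (intro maj_nonneg) (auto intro: less_imp_le)

text \<open>Applying \<open>\<sigma>\<close> moves the parameter of the geometric series from
  \<open>c * S l\<close> to \<open>c * S (Suc l)\<close> and multiplies the numerator by
  \<open>\<xi> * \<tau>\<close>; the row sums of the next matrix contribute
  \<open>R (Suc l)\<close>. The first direction is split off because the value of a layer is not
  under control.\<close>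

lemma abs_der_layer_le:
  assumes "l \<le> L" "p < d (Suc l)" "set (j # js) \<subseteq> {..<s}" "y \<in> dom"
  shows "\<bar>der (j # js) (N l p) y\<bar>
    \<le> \<omega> * b j * M js (fps_const (c * P l) * geo (c * S l) ^ 2) ((\<lambda>_. 0)(j := Suc 0))"
  using assms(1-3)
proof (induction l arbitrary: p j js)
  case 0
  \<comment> \<open>Since \<open>S 0 = 0\<close> and \<open>P 0 = 1\<close>, the general bound
    reduces at the input layer to the constant series \<open>c\<close>.\<close>
  have "geo 0 = 1" by (rule fps_ext) (simp add: power_0_left)
  then have eq: "fps_const (c * P 0) * geo (c * S 0) ^ 2 = fps_const c"
    by (simp add: Pk_def SL_def)
  show ?case unfolding eq by (rule abs_der_input_layer_le) (use 0 assms(4) in auto)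
next
  case (Suc l)
  define A where "A = c * S (Suc l)"
  define a where "a = c * S l"
  define Q where "Q = geo A * (1 - fps_const a * fps_X)"
  define e where "e = (\<lambda>_. 0)(j := Suc 0)"
  note Q = geo_quotient_deriv[OF Q_def]
  have Aa: "A - a = \<tau> * (c * P l)" by (simp add: A_def a_def S_Suc algebra_simps)
  have A0: "A \<ge> 0" unfolding A_def using S_nonneg[of "Suc l"] Suc.prems pos by simp
  have Q': "fps_deriv Q = fps_const \<tau> * (fps_const (c * P l) * geo (c * S l) ^ 2) * Q ^ 2"
  proof -
    have "fps_deriv Q = fps_const \<tau> * fps_const (c * P l) * (geo a ^ 2 * Q ^ 2)"
      unfolding Q(1,2) Aa by simp
    then show ?thesis by (simp only: a_def mult_ac)
  qed
  \<comment> \<open>The bound does not depend on the neuron \<open>q\<close>, so only the row sum of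
    absolute weights enters afterwards.\<close>
  define K where "K = \<omega> * b j * (\<xi> * \<tau> * (c * P l) * M js (geo A ^ 2) e)"
  have bound: "\<bar>der (j # js) (\<lambda>y. \<sigma> (N l q y)) y\<bar>
      \<le> K" if "q < d (Suc l)" for q
  proof -
    have IH: "\<bar>der (i # ls) (N l q) y\<bar>
      \<le> \<omega> * b i * M ls (fps_const (c * P l) * geo (c * S l) ^ 2) ((\<lambda>_. 0)(i := Suc 0))"
      if "set (i # ls) \<subseteq> {..<s}" for i ls
      by (rule Suc.IH[OF _ \<open>q < d (Suc l)\<close> that]) (use Suc.prems in simp)
    \<comment> \<open>The composition bound is used at order \<open>k = 0\<close>, which is
      admissible because the list is nonempty.\<close>
    have "\<bar>der (j # js) (\<lambda>y. h 0 (N l q y)) y\<bar>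
        \<le> M (j # js) (fps_const (\<xi> * \<tau> ^ 0 * fact 0) * Q ^ Suc 0) (\<lambda>_. 0)"
      by (rule abs_der_compose_le[OF h_deriv h_bound smooth_net assms(4) IH Q' Q(3) Suc.prems(3)])
        auto
    also have "\<dots> = \<omega> * b j * M js (fps_const (\<xi> * (A - a)) * geo A ^ 2) e"
      by (simp add: Q(1) e_def mult.assoc[symmetric])
    finally show ?thesis unfolding maj_cmult Aa h0 K_def by (simp only: mult_ac)
  qed
  have nn: "0 \<le> K"
    unfolding K_def
    using pos P_pos[of l] Suc.prems M_nonneg[OF geo_power_nonneg[OF A0]]
    by (intro mult_nonneg_nonneg) (auto intro: less_imp_le)
  have sm: "smooth (\<lambda>y. \<sigma> (N l q y))" for q
    using smooth_compose[of h, OF h_deriv smooth_net, of 0 l q] by (simp add: h0)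
  have "der (j # js) (N (Suc l) p) y
      = (\<Sum>q<d (Suc l). W (Suc l) p q * der (j # js) (\<lambda>y. \<sigma> (N l q y)) y)"
    unfolding net.simps using sm Suc.prems assms(4) by (intro der_affine) auto
  also have "\<bar>\<dots>\<bar> \<le> (\<Sum>q<d (Suc l). \<bar>W (Suc l) p q\<bar> * K)"
  proof (rule order_trans[OF sum_abs sum_mono])
    fix q assume "q \<in> {..<d (Suc l)}"
    then show "\<bar>W (Suc l) p q * der (j # js) (\<lambda>y. \<sigma> (N l q y)) y\<bar>
        \<le> \<bar>W (Suc l) p q\<bar> * K"
      unfolding abs_mult by (intro mult_left_mono[OF bound]) simp_all
  qed
  also have "\<dots> = (\<Sum>q<d (Suc l). \<bar>W (Suc l) p q\<bar>) * K"
    by (simp only: sum_distrib_right)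
  also have "\<dots> \<le> R (Suc l) * K"
    using W_norm[of "Suc l" p] Suc.prems nn by (intro mult_right_mono) auto
  also have "\<dots> = \<omega> * b j * M js (fps_const (c * P (Suc l)) * geo A ^ 2) e"
    unfolding maj_cmult P_Suc K_def by (simp only: mult_ac)
  finally show ?case unfolding A_def e_def .
qed

text \<open>The two entries of the maximum C_L serve two cases. The empty list asks for the value of
  the network. A nonempty list gives the constant \<open>c * P L\<close>, which is
  \<open>P L / S L\<close>, and the series \<open>geo 1 ^ 2\<close>, which is the derivative of
  \<open>geo 1\<close>.\<close>

lemma abs_der_net_le:
  assumes "c = 1 / S L" "S L > 0" "p < d (Suc L)" "set js \<subseteq> {..<s}" "y \<in> dom"
    and "\<bar>N L p y\<bar> \<le> C" "P L / S L \<le> C"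
  shows "\<bar>der js (N L p) y\<bar> \<le> C * M js (geo 1) (\<lambda>_. 0)"
proof (cases js)
  case Nil
  then show ?thesis using assms(6) by simp
next
  case (Cons j ls)
  have "c * S L = 1" using assms(1,2) by simp
  then have "\<bar>der js (N L p) y\<bar> \<le> \<omega> * b j * M ls (fps_const (c * P L) * geo 1 ^ 2) ((\<lambda>_. 0)(j := Suc 0))"
    using abs_der_layer_le[of L p j ls y] assms Cons by (simp del: der_Cons)
  also have "\<dots> = c * P L * M js (geo 1) (\<lambda>_. 0)"
    unfolding maj_cmult Cons by (simp add: geo_deriv)
  also have "\<dots> \<le> C * M js (geo 1) (\<lambda>_. 0)"
    using assms(1,7) by (intro mult_right_mono M_nonneg) auto
  finally show ?thesis .
qed

end

section \<open>The Sobolev and Korobov norms\<close>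

lemma space_unitI [simp]: "space unitI = {0..1}"
  by (simp add: unitI_def space_restrict_space)

lemma prob_space_unitI: "prob_space unitI"
  by (rule prob_spaceI) (simp add: unitI_def space_restrict_space emeasure_restrict_space)

lemma prob_space_PiM_unitI: "prob_space (PiM A (\<lambda>_. unitI))"
  by (rule prob_space_PiM) (rule prob_space_unitI)

lemma space_PiM_unitI: "space (PiM A (\<lambda>_. unitI)) = PiE A (\<lambda>_. {0..1})"
  by (simp add: space_PiM)

text \<open>No measurability is needed: the integral of a function that is not integrable is \<open>0\<close>.\<close>

lemma (in prob_space) norm_integral_le_bound:
  fixes f :: "'a \<Rightarrow> 'b::{banach, second_countable_topology}"
  assumes "\<And>x. x \<in> space M \<Longrightarrow> norm (f x) \<le> B"
  shows "norm (integral\<^sup>L M f) \<le> B"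
proof (cases "integrable M f")
  case True
  have "norm (integral\<^sup>L M f) \<le> (\<integral>x. norm (f x) \<partial>M)" by simp
  also have "\<dots> \<le> (\<integral>x. B \<partial>M)"
    using True assms by (intro integral_mono) auto
  also have "\<dots> = B" by (simp add: prob_space)
  finally show ?thesis .
next
  case False
  obtain x where "x \<in> space M" using not_empty by blast
  then have "0 \<le> B" using assms norm_ge_zero order_trans by blast
  then show ?thesis using False by (simp add: not_integrable_integral_eq)
qed

lemma merge_in_cube:
  assumes "u \<subseteq> {..<s}" "yu \<in> PiE u (\<lambda>_. {0..1})" "yv \<in> PiE ({..<s} - u) (\<lambda>_. {0..1})"
  shows "merge u ({..<s} - u) (yu, yv) \<in> cube s"
  unfolding cube_def
proof (rule PiE_I)
  fix j assume "j \<in> {..<s}"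
  then show "merge u ({..<s} - u) (yu, yv) j \<in> {0..1}"
    using assms(2,3) by (cases "j \<in> u") (auto simp: merge_def PiE_iff)
next
  fix j assume "j \<notin> {..<s}"
  then show "merge u ({..<s} - u) (yu, yv) j = undefined"
    using assms(1) by (auto simp: merge_def)
qed

text \<open>Both integrals are taken against probability measures, so a pointwise bound passes
  through the inner integral, the square and the outer integral unchanged.\<close>

lemma sob_sq_le:
  assumes "\<And>u y. u \<subseteq> {..<s} \<Longrightarrow> y \<in> cube s \<Longrightarrow> \<bar>dmulti {0..1} s (alpha_u \<alpha> u) F y\<bar> \<le> B u"
    and "\<And>u. u \<subseteq> {..<s} \<Longrightarrow> \<gamma> u > 0"
  shows "sob_sq s \<alpha> \<gamma> F \<le> (\<Sum>u\<in>Pow {..<s}. (1 / \<gamma> u) * (B u)^2)"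
  unfolding sob_sq_def
proof (intro sum_mono mult_left_mono)
  fix u assume "u \<in> Pow {..<s}"
  then have u: "u \<subseteq> {..<s}" by simp
  show "0 \<le> 1 / \<gamma> u" using assms(2)[OF u] by simp
  let ?V = "{..<s} - u"
  define inner where "inner yu = (\<integral>yv. dmulti {0..1} s (alpha_u \<alpha> u) F (merge u ?V (yu, yv)) \<partial>(PiM ?V (\<lambda>_. unitI)))" for yu
  have in1: "\<bar>inner yu\<bar> \<le> B u" if "yu \<in> PiE u (\<lambda>_. {0..1})" for yu
  proof -
    interpret V: prob_space "PiM ?V (\<lambda>_. unitI)" by (rule prob_space_PiM_unitI)
    have "norm (inner yu) \<le> B u" unfolding inner_def
    proof (rule V.norm_integral_le_bound)
      fix yv assume "yv \<in> space (PiM ?V (\<lambda>_. unitI))"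
      then show "norm (dmulti {0..1} s (alpha_u \<alpha> u) F (merge u ?V (yu, yv))) \<le> B u"
        using assms(1)[OF u merge_in_cube[OF u that]] by (simp add: space_PiM_unitI)
    qed
    then show ?thesis by simp
  qed
  interpret U: prob_space "PiM u (\<lambda>_. unitI)" by (rule prob_space_PiM_unitI)
  have "norm (\<integral>yu. (inner yu)^2 \<partial>(PiM u (\<lambda>_. unitI))) \<le> (B u)^2"
  proof (rule U.norm_integral_le_bound)
    fix yu assume "yu \<in> space (PiM u (\<lambda>_. unitI))"
    then have "\<bar>inner yu\<bar> \<le> B u" using in1 by (simp add: space_PiM_unitI)
    then have "\<bar>inner yu\<bar>^2 \<le> (B u)^2" by (intro power_mono) auto
    then show "norm ((inner yu)^2) \<le> (B u)^2" by simp
  qed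
  then show "(\<integral>yu. (\<integral>yv. dmulti {0..1} s (alpha_u \<alpha> u) F (merge u ?V (yu, yv))
      \<partial>(PiM ?V (\<lambda>_. unitI))) ^ 2 \<partial>(PiM u (\<lambda>_. unitI))) \<le> (B u)^2"
    by (simp add: inner_def)
qed

text \<open>Directions outside \<open>u\<close> drop out of the list, so \<open>maj_Stirling\<close>
  can be applied to the members of \<open>u\<close> alone and its sum runs over functions on
  \<open>u\<close>.\<close>

lemma dlist_alpha_u:
  assumes "u \<subseteq> {..<s}"
  shows "dlist s (alpha_u \<alpha> u) = concat (map (replicate \<alpha>) (filter (\<lambda>j. j \<in> u) [0..<s]))"
proof -
  have "concat (map (\<lambda>j. replicate (alpha_u \<alpha> u j) j) xs)
      = concat (map (replicate \<alpha>) (filter (\<lambda>j. j \<in> u) xs))" for xs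
    by (induction xs) (auto simp: alpha_u_def)
  then show ?thesis by (simp add: dlist_def)
qed

lemma prod_list_dlist: "prod_list (map f (dlist s \<nu>)) = (\<Prod>j<s. (f j :: real) ^ \<nu> j)"
proof -
  have "prod_list (map f (replicate n j)) = f j ^ n" for n j
    by (induction n) auto
  then have "prod_list (map f (concat (map (\<lambda>j. replicate (\<nu> j) j) xs))) = prod_list (map (\<lambda>j. f j ^ \<nu> j) xs)" for xs
    by (induction xs) auto
  then show ?thesis unfolding dlist_def
    by (simp add: prod.distinct_set_conv_list[symmetric] lessThan_atLeast0)
qed

lemma set_dlist: "set (dlist s \<nu>) \<subseteq> {..<s}"
  by (auto simp: dlist_def)

section \<open>Fourier coefficients of smooth periodic functions\<close>

locale real_domain =
  fixes s :: nat
begin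

sublocale product_domain "UNIV :: real set" s
  by unfold_locales simp

definition periodic :: "((nat \<Rightarrow> real) \<Rightarrow> real) \<Rightarrow> bool" where
  "periodic F \<longleftrightarrow> (\<forall>y\<in>dom. \<forall>j<s. F (y(j := y j + 1)) = F y)"

abbreviation M :: "(nat \<Rightarrow> real) measure" where
  "M \<equiv> PiM {..<s} (\<lambda>_. unitI)"

lemma space_M: "space M = cube s"
  by (simp add: space_PiM_unitI cube_def)

lemma cube_subset_dom: "cube s \<subseteq> dom"
  unfolding cube_def by (rule PiE_mono) simp

lemma has_derivative_dpartial:
  assumes "smooth F" "j < s" "y \<in> dom"
  shows "((\<lambda>t. F (y(j := t))) has_real_derivative dpartial UNIV j F (y(j := x))) (at x)"
  using smooth_partial_deriv[OF assms(1,2)] dom_upd[OF assms(3,2) UNIV_I, of x]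
  unfolding partial_deriv_def by force

text \<open>Repeated integration by parts needs periodicity of every derivative. A shift in another
  coordinate commutes with the derivative; a shift in the same coordinate gives two derivatives of
  one function at one point, which agree by uniqueness.\<close>

lemma periodic_dpartial:
  assumes "smooth F" "periodic F" "j < s"
  shows "periodic (dpartial UNIV j F)"
  unfolding periodic_def
proof (intro ballI allI impI)
  fix y i assume y: "y \<in> dom" and i: "i < s"
  have per: "F (z(i := z i + 1)) = F z" if "z \<in> dom" for z
    using assms(2) that i unfolding periodic_def by blast
  show "dpartial UNIV j F (y(i := y i + 1)) = dpartial UNIV j F y"
  proof (cases "i = j")
    case False
    have "F (y(i := y i + 1, j := t)) = F (y(j := t))" for t
      using per[OF dom_upd[OF y assms(3) UNIV_I], of t] False by (simp add: fun_upd_twist)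
    then show ?thesis using False by (simp add: dpartial_def)
  next
    case True
    let ?f = "\<lambda>t. F (y(j := t))"
    have eq: "(\<lambda>t. ?f (t + 1)) = ?f"
      using per[OF dom_upd[OF y assms(3) UNIV_I]] True by (auto simp: fun_eq_iff)
    have "(?f has_real_derivative dpartial UNIV j F (y(j := y j + 1))) (at (y j + 1))"
      by (rule has_derivative_dpartial[OF assms(1,3) y])
    then have "(?f has_real_derivative dpartial UNIV j F (y(j := y j + 1))) (at (y j))"
      using DERIV_shift[of ?f _ "y j" 1] eq by simp
    moreover have "(?f has_real_derivative dpartial UNIV j F y) (at (y j))"
      using has_derivative_dpartial[OF assms(1,3) y, of "y j"] by simp
    ultimately show ?thesis using True DERIV_unique by blast
  qed
qed

lemma component_measurable: "j < s \<Longrightarrow> (\<lambda>y. y j) \<in> borel_measurable M"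
proof -
  assume "j < s"
  then have "(\<lambda>y. y j) \<in> measurable M unitI"
    by (intro measurable_component_singleton) simp
  then show ?thesis unfolding unitI_def by (simp add: measurable_restrict_space2_iff)
qed

text \<open>The derivative is the limit of difference quotients, where periodicity is used to keep the
  shifted point in the cube.\<close>

lemma measurable_dpartial:
  assumes "smooth F" "periodic F" "j < s" "F \<in> borel_measurable M"
  shows "dpartial UNIV j F \<in> borel_measurable M"
proof -
  define \<epsilon> where "\<epsilon> n = inverse (real (Suc n))" for n
  have \<epsilon>: "0 < \<epsilon> n" "\<epsilon> n \<le> 1" for n by (simp_all add: \<epsilon>_def inverse_le_1_iff)
  define r where "r n t = (if t + \<epsilon> n \<le> 1 then t + \<epsilon> n else t + \<epsilon> n - 1)" for n t
  define D where "D n y = (F (y(j := r n (y j))) - F y) / \<epsilon> n" for n y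
  note comp[measurable] = component_measurable[OF assms(3)]
  show ?thesis
  proof (rule borel_measurable_LIMSEQ_real)
    fix n
    have "(\<lambda>y. r n (y j)) \<in> measurable M (restrict_space lborel {0..1})"
    proof (rule measurable_restrict_space2)
      show "(\<lambda>y. r n (y j)) \<in> space M \<rightarrow> {0..1}"
      proof
        fix y assume "y \<in> space M"
        then have "y j \<in> {0..1}"
          using PiE_mem[of y "{..<s}" "\<lambda>_. {0..1}" j] assms(3) by (simp add: space_M cube_def)
        then show "r n (y j) \<in> {0..1}" using \<epsilon>[of n] by (auto simp: r_def)
      qed
      show "(\<lambda>y. r n (y j)) \<in> measurable M lborel"
        unfolding r_def by measurable
    qed
    then have "(\<lambda>y. r n (y j)) \<in> measurable M unitI" by (simp only: unitI_def)
    then have "(\<lambda>y. y(j := r n (y j))) \<in> measurable M M"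
      using assms(3) by (intro measurable_fun_upd[where J = "{..<s}"]) auto
    from measurable_compose[OF this assms(4)]
    show "D n \<in> borel_measurable M" unfolding D_def using assms(4) by simp
  next
    fix y assume "y \<in> space M"
    then have y: "y \<in> dom" using cube_subset_dom by (auto simp: space_M)
    have "((\<lambda>t. F (y(j := t))) has_real_derivative dpartial UNIV j F y) (at (y j))"
      using has_derivative_dpartial[OF assms(1,3) y, of "y j"] by simp
    then have lim: "((\<lambda>h. (F (y(j := y j + h)) - F y) / h) \<longlongrightarrow> dpartial UNIV j F y) (at 0)"
      by (simp add: DERIV_def)
    have "\<epsilon> \<longlonglongrightarrow> 0"
      unfolding \<epsilon>_def[abs_def] by (rule LIMSEQ_inverse_real_of_nat)
    then have "filterlim \<epsilon> (at 0) sequentially"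
      unfolding filterlim_at using \<epsilon>(1) by (simp add: less_imp_neq[THEN not_sym])
    from filterlim_compose[OF lim this]
    have "(\<lambda>n. (F (y(j := y j + \<epsilon> n)) - F y) / \<epsilon> n) \<longlonglongrightarrow> dpartial UNIV j F y" .
    moreover have "F (y(j := y j + \<epsilon> n)) = F (y(j := r n (y j)))" for n
      using assms(2,3) dom_upd[OF y assms(3) UNIV_I, of "y j + \<epsilon> n - 1"]
      unfolding periodic_def r_def by force
    ultimately show "(\<lambda>n. D n y) \<longlonglongrightarrow> dpartial UNIV j F y"
      by (simp add: D_def)
  qed
qed

definition wave :: "(nat \<Rightarrow> int) \<Rightarrow> (nat \<Rightarrow> real) \<Rightarrow> complex" where
  "wave h y = cis (- 2 * pi * (\<Sum>j<s. real_of_int (h j) * y j))"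

lemma fourier_coeff_wave: "fourier_coeff s F h = (\<integral>y. complex_of_real (F y) * wave h y \<partial>M)"
  by (simp add: fourier_coeff_def wave_def)

lemma norm_wave [simp]: "norm (wave h y) = 1"
  by (simp add: wave_def)

lemma wave_measurable: "wave h \<in> borel_measurable M"
proof -
  have "(\<lambda>y. - 2 * pi * (\<Sum>j<s. real_of_int (h j) * y j)) \<in> borel_measurable M"
    by (intro borel_measurable_times borel_measurable_const borel_measurable_sum component_measurable) simp
  then have "(\<lambda>y. cis (- 2 * pi * (\<Sum>j<s. real_of_int (h j) * y j))) \<in> borel_measurable M"
    by (rule measurable_compose) (intro borel_measurable_continuous_onI continuous_intros)
  then show ?thesis by (simp add: wave_def[abs_def])
qed

lemma wave_upd_deriv:
  assumes "j < s"
  shows "((\<lambda>t. wave h (y(j := t))) has_vector_derivative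
    (- 2 * pi * real_of_int (h j)) *\<^sub>R (\<i> * wave h (y(j := t)))) (at t within A)"
proof -
  define c where "c = (\<Sum>i\<in>{..<s} - {j}. real_of_int (h i) * y i)"
  have eq: "wave h (y(j := t)) = cis (- 2 * pi * (real_of_int (h j) * t + c))" for t
  proof -
    have "(\<Sum>i<s. real_of_int (h i) * (y(j := t)) i) = real_of_int (h j) * t + c"
      unfolding c_def using assms by (subst sum.remove[of _ j]) auto
    then show ?thesis by (simp only: wave_def)
  qed
  have "((\<lambda>t. - 2 * pi * (real_of_int (h j) * t + c)) has_real_derivative - 2 * pi * real_of_int (h j)) (at t within A)"
    by (auto intro!: derivative_eq_intros)
  from has_derivative_cis[OF this[unfolded has_field_derivative_def]] show ?thesis
    unfolding eq has_vector_derivative_def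
    by (rule has_derivative_eq_rhs) (simp add: fun_eq_iff scaleR_conv_of_real mult_ac)
qed

lemma wave_upd_shift:
  assumes "j < s"
  shows "wave h (y(j := t + 1)) = wave h (y(j := t))"
proof -
  have "(\<Sum>i<s. real_of_int (h i) * (y(j := t + 1)) i)
      = (\<Sum>i<s. real_of_int (h i) * (y(j := t)) i) + real_of_int (h j)"
    using assms by (subst (1 2) sum.remove[of _ j]) (auto simp: algebra_simps)
  then have "wave h (y(j := t + 1)) = wave h (y(j := t)) * cis (2 * pi * real_of_int (- h j))"
    unfolding wave_def cis_mult by (simp add: algebra_simps)
  moreover have "cis (2 * pi * real_of_int (- h j)) = 1" by (rule cis_multiple_2pi) simp
  ultimately show ?thesis by simp
qed

text \<open>Integration by parts in the coordinate \<open>j\<close>: Fubini reduces it to line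
  integrals over one period, and the boundary terms cancel since both \<open>F\<close> and
  \<open>wave h\<close> are periodic. The two bounds provide integrability.\<close>

lemma fourier_coeff_dpartial:
  assumes "smooth F" "periodic F" "j < s" "F \<in> borel_measurable M"
    and B: "\<And>y. y \<in> cube s \<Longrightarrow> \<bar>F y\<bar> \<le> B" "\<And>y. y \<in> cube s \<Longrightarrow> \<bar>dpartial UNIV j F y\<bar> \<le> B'"
  shows "fourier_coeff s (dpartial UNIV j F) h
    = 2 * pi * real_of_int (h j) * \<i> * fourier_coeff s F h"
proof -
  interpret Pr: prob_space M by (rule prob_space_PiM_unitI)
  interpret ps: product_sigma_finite "\<lambda>_::nat. unitI"
    by (rule product_sigma_finite.intro) (rule prob_space_imp_sigma_finite[OF prob_space_unitI])
  define F' where "F' = dpartial UNIV j F"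
  define k where "k = - 2 * pi * real_of_int (h j)"
  have int: "integrable M (\<lambda>y. complex_of_real (f y) * wave h y)"
    if "f \<in> borel_measurable M" "\<And>y. y \<in> cube s \<Longrightarrow> \<bar>f y\<bar> \<le> B" for f B
    using that wave_measurable
    by (intro Pr.integrable_const_bound[where B = B] AE_I2) (auto simp: norm_mult space_M)
  have iF: "integrable M (\<lambda>y. complex_of_real (F y) * wave h y)"
    using int assms(4) B(1) by blast
  have iF': "integrable M (\<lambda>y. complex_of_real (F' y) * wave h y)"
    using int measurable_dpartial[OF assms(1-4)] B(2) unfolding F'_def by blast
  \<comment> \<open>This is the partial derivative of \<open>F y * wave h y\<close> in direction
    \<open>j\<close>; its integral is the difference of the two sides of the claim.\<close>
  define g where "g y = complex_of_real (F' y) * wave h y + (k * \<i>) * (complex_of_real (F y) * wave h y)" for y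
  have ig: "integrable M g" unfolding g_def 
    using iF iF' by (intro Bochner_Integration.integrable_add integrable_mult_right) auto
  let ?J = "{..<s} - {j}"
  have ins: "insert j ?J = {..<s}" using assms(3) by auto
  have zero: "(\<integral>t. g (x(j := t)) \<partial>unitI) = 0" if x: "x \<in> PiE ?J (\<lambda>_. {0..1})" for x
  proof -
    define H where "H t = complex_of_real (F (x(j := t))) * wave h (x(j := t))" for t
    have xd: "x(j := 0) \<in> dom" using x assms(3) by (auto simp: PiE_iff extensional_def)
    have dF: "((\<lambda>t. F (x(j := t))) has_real_derivative F' (x(j := t))) (at t)" for t
      using has_derivative_dpartial[OF assms(1,3) xd, of t] unfolding F'_def by simp
    \<comment> \<open>The second derivative serves to make \<open>F'\<close> continuous along the
      line, as the fundamental theorem of calculus requires.\<close>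
    have dF': "((\<lambda>t. F' (x(j := t))) has_real_derivative dpartial UNIV j F' (x(j := t))) (at t)" for t
      using has_derivative_dpartial[OF smooth_dpartial[OF assms(1,3)] assms(3) xd, of t]
      unfolding F'_def by simp
    have dH: "(H has_vector_derivative g (x(j := t))) (at t)" for t
    proof -
      have "(H has_vector_derivative
          complex_of_real (F (x(j := t))) * (k *\<^sub>R (\<i> * wave h (x(j := t))))
          + complex_of_real (F' (x(j := t))) * wave h (x(j := t))) (at t)"
        unfolding H_def k_def
        by (intro has_vector_derivative_mult has_vector_derivative_of_real
            wave_upd_deriv[OF assms(3)] dF)
      then show ?thesis by (simp add: g_def scaleR_conv_of_real mult_ac add.commute)
    qed
    have cF: "continuous_on A (\<lambda>t. F (x(j := t)))" "continuous_on A (\<lambda>t. F' (x(j := t)))"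
      "continuous_on A (\<lambda>t. wave h (x(j := t)))" for A
      using DERIV_isCont[OF dF] DERIV_isCont[OF dF']
        has_vector_derivative_continuous[OF wave_upd_deriv[OF assms(3), of h x _ UNIV]]
      by (auto intro!: continuous_at_imp_continuous_on)
    have "(\<integral>t. g (x(j := t)) \<partial>unitI) = (\<integral>t. indicator {0..1} t *\<^sub>R g (x(j := t)) \<partial>lborel)"
      unfolding unitI_def by (rule integral_restrict_space) simp
    also have "\<dots> = H 1 - H 0"
    proof (rule integral_FTC_atLeastAtMost)
      show "continuous_on {0..1} (\<lambda>t. g (x(j := t)))"
        unfolding g_def by (intro continuous_intros cF)
    qed (auto intro: has_vector_derivative_at_within dH)
    also have "\<dots> = 0"
    proof -
      have "F (x(j := 0 + 1)) = F (x(j := 0))"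
        using assms(2,3) xd unfolding periodic_def by force
      then show ?thesis using wave_upd_shift[OF assms(3), of h x 0] by (simp add: H_def)
    qed
    finally show ?thesis .
  qed
  have "integral\<^sup>L M g = (\<integral>x. (\<integral>t. g (x(j := t)) \<partial>unitI) \<partial>PiM ?J (\<lambda>_. unitI))"
    using ps.product_integral_insert[of ?J j g, unfolded ins] ig by blast
  also have "\<dots> = (\<integral>x. 0 \<partial>PiM ?J (\<lambda>_. unitI))"
    using zero by (intro Bochner_Integration.integral_cong refl) (simp add: space_PiM_unitI)
  finally have "integral\<^sup>L M g = 0" by simp
  moreover have "integral\<^sup>L M g = fourier_coeff s F' h + k * \<i> * fourier_coeff s F h"
    unfolding g_def fourier_coeff_wave using iF iF' by simp
  ultimately show ?thesis by (simp add: F'_def k_def eq_neg_iff_add_eq_0 algebra_simps)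
qed

text \<open>Each integration by parts requires a bounded function with a bounded derivative. Bounds
  over all subsequences of the list are inherited when the head of \<open>js\<close> is moved into
  \<open>F\<close>.\<close>

lemma norm_fourier_coeff_der:
  assumes "smooth F" "periodic F" "F \<in> borel_measurable M" "set js \<subseteq> {..<s}"
    and "\<And>l. subseq l js \<Longrightarrow> \<exists>B. \<forall>y\<in>cube s. \<bar>der l F y\<bar> \<le> B"
  shows "cmod (fourier_coeff s (der js F) h)
    = prod_list (map (\<lambda>j. 2 * pi * \<bar>real_of_int (h j)\<bar>) js) * cmod (fourier_coeff s F h)"
  using assms
proof (induction js arbitrary: F)
  case (Cons j js)
  have j: "j < s" using Cons.prems by simp
  obtain B B' where "\<And>y. y \<in> cube s \<Longrightarrow> \<bar>F y\<bar> \<le> B" "\<And>y. y \<in> cube s \<Longrightarrow> \<bar>dpartial UNIV j F y\<bar> \<le> B'"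
    using Cons.prems(5)[of "[]"] Cons.prems(5)[of "[j]"] by auto
  from fourier_coeff_dpartial[OF Cons.prems(1,2) j Cons.prems(3) this]
  have eq: "cmod (fourier_coeff s (dpartial UNIV j F) h)
      = 2 * pi * \<bar>real_of_int (h j)\<bar> * cmod (fourier_coeff s F h)"
    by (simp add: norm_mult)
  have "\<exists>B. \<forall>y\<in>cube s. \<bar>der l (dpartial UNIV j F) y\<bar> \<le> B" if "subseq l js" for l
    using Cons.prems(5)[of "j # l"] that by simp
  then have "cmod (fourier_coeff s (der js (dpartial UNIV j F)) h)
      = prod_list (map (\<lambda>j. 2 * pi * \<bar>real_of_int (h j)\<bar>) js) * cmod (fourier_coeff s (dpartial UNIV j F) h)"
    using Cons.prems j
    by (intro Cons.IH smooth_dpartial periodic_dpartial measurable_dpartial) auto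
  then show ?case by (simp add: eq)
qed simp

text \<open>Multiplying the integrand by the conjugate wave recovers \<open>F\<close>, so the
  integrand cannot be integrable, and its integral has the default value 0.\<close>

lemma fourier_coeff_not_measurable:
  assumes "F \<notin> borel_measurable M"
  shows "fourier_coeff s F h = 0"
proof -
  have "\<not> integrable M (\<lambda>y. complex_of_real (F y) * wave h y)"
  proof
    assume "integrable M (\<lambda>y. complex_of_real (F y) * wave h y)"
    then have "(\<lambda>y. complex_of_real (F y) * wave h y) \<in> borel_measurable M" by simp
    moreover have "(\<lambda>y. cnj (wave h y)) \<in> borel_measurable M"
      by (rule measurable_compose[OF wave_measurable])
        (intro borel_measurable_continuous_onI continuous_intros)
    ultimately have "(\<lambda>y. Re (complex_of_real (F y) * wave h y * cnj (wave h y))) \<in> borel_measurable M"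
      by (intro measurable_compose[OF borel_measurable_times, of _ M _ Re])
        (auto intro!: borel_measurable_continuous_onI continuous_intros)
    moreover have "Re (complex_of_real (F y) * wave h y * cnj (wave h y)) = F y" for y
      by (simp add: mult.assoc complex_norm_square[symmetric])
    ultimately show False using assms by simp
  qed
  then show ?thesis by (simp add: fourier_coeff_wave not_integrable_integral_eq)
qed

text \<open>Each frequency is matched with its support \<open>u\<close>: taking \<alpha> derivatives
  in every direction of \<open>u\<close> multiplies the coefficient by all factors
  \<open>(2 * pi * \<bar>h j\<bar>) ^ \<alpha>\<close>, which dominate the numerator of
  \<open>r_alpha\<close>. The coefficient of the derivative is at most its supremum, since the wave
  has modulus one.\<close>

lemma korobov_norm_le:
  assumes "smooth F" "periodic F"
    and "\<And>\<nu> l. subseq l (rev (dlist s \<nu>)) \<Longrightarrow> \<exists>B. \<forall>y\<in>cube s. \<bar>der l F y\<bar> \<le> B"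
    and "\<And>u y. u \<subseteq> {..<s} \<Longrightarrow> y \<in> cube s \<Longrightarrow> \<bar>dmulti UNIV s (alpha_u \<alpha> u) F y\<bar> \<le> B u"
    and "\<And>u. u \<subseteq> {..<s} \<Longrightarrow> \<gamma> u > 0" "\<And>u. u \<subseteq> {..<s} \<Longrightarrow> B u / \<gamma> u \<le> K"
  shows "korobov_norm s \<alpha> \<gamma> F \<le> K"
  unfolding korobov_norm_def
proof (rule cSUP_least)
  show "PiE {..<s} (\<lambda>_. UNIV :: int set) \<noteq> {}" by (simp add: PiE_eq_empty_iff)
  fix h :: "nat \<Rightarrow> int"
  define u where "u = supp_int s h"
  have u: "u \<subseteq> {..<s}" by (auto simp: u_def supp_int_def)
  interpret Pr: prob_space M by (rule prob_space_PiM_unitI)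
  \<comment> \<open>The origin lies in the cube, so \<open>B u\<close> dominates an absolute value;
    this settles the case of a non-measurable \<open>F\<close>.\<close>
  have B0: "B u \<ge> 0"
  proof -
    have "(\<lambda>j\<in>{..<s}. 0) \<in> cube s" by (auto simp: cube_def)
    from assms(4)[OF u this] show ?thesis by linarith
  qed
  define p where "p = (\<Prod>j\<in>u. \<bar>real_of_int (h j)\<bar> ^ \<alpha>)"
  have p0: "p \<ge> 0" unfolding p_def by (intro prod_nonneg) auto
  have "p * cmod (fourier_coeff s F h) \<le> B u"
  proof (cases "F \<in> borel_measurable M")
    case True
    let ?js = "rev (dlist s (alpha_u \<alpha> u))"
    have "prod_list (map (\<lambda>j. 2 * pi * \<bar>real_of_int (h j)\<bar>) ?js)
        = (\<Prod>j<s. (2 * pi * \<bar>real_of_int (h j)\<bar>) ^ alpha_u \<alpha> u j)"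
      by (simp add: rev_map[symmetric] prod_list_dlist)
    also have "\<dots> = (\<Prod>j\<in>u. (2 * pi * \<bar>real_of_int (h j)\<bar>) ^ \<alpha>)"
      using u by (intro prod.mono_neutral_cong_right) (auto simp: alpha_u_def)
    \<comment> \<open>The powers of \<open>2 * pi\<close> are given away here, which is why they
      remain in the final Korobov bounds.\<close>
    also have "\<dots> \<ge> p"
      unfolding p_def
    proof (intro prod_mono conjI power_mono)
      fix j
      have "1 * \<bar>real_of_int (h j)\<bar> \<le> 2 * pi * \<bar>real_of_int (h j)\<bar>"
        using pi_gt3 by (intro mult_right_mono) auto
      then show "\<bar>real_of_int (h j)\<bar> \<le> 2 * pi * \<bar>real_of_int (h j)\<bar>" by simp
    qed auto
    finally have "p * cmod (fourier_coeff s F h)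
        \<le> prod_list (map (\<lambda>j. 2 * pi * \<bar>real_of_int (h j)\<bar>) ?js) * cmod (fourier_coeff s F h)"
      by (intro mult_right_mono) auto
    also have "\<dots> = cmod (fourier_coeff s (der ?js F) h)"
      using assms(1-3) True set_dlist by (intro norm_fourier_coeff_der[symmetric]) auto
    also have "\<dots> \<le> B u"
      unfolding fourier_coeff_wave
    proof (rule Pr.norm_integral_le_bound)
      fix y assume "y \<in> space M"
      then show "cmod (complex_of_real (der ?js F y) * wave h y) \<le> B u"
        using assms(4)[OF u, of y] by (simp add: norm_mult space_M dmulti_def diter_eq_der)
    qed
    finally show ?thesis .
  next
    case False
    then show ?thesis using B0 by (simp add: fourier_coeff_not_measurable)
  qed
  then have "p * cmod (fourier_coeff s F h) / \<gamma> u \<le> B u / \<gamma> u"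
    using assms(5)[OF u] by (intro divide_right_mono) auto
  also have "\<dots> \<le> K" by (rule assms(6)[OF u])
  finally show "cmod (fourier_coeff s F h) * r_alpha s \<alpha> \<gamma> h \<le> K"
    by (simp add: r_alpha_def u_def[symmetric] p_def mult.commute)
qed

end

lemma product_domain_unit: "product_domain {0..1}"
  by unfold_locales (simp add: trivial_limit_within)

text \<open>\<open>sob_sq\<close> differentiates within the cube, one-sidedly at its boundary,
  whereas the periodic bounds concern derivatives on the whole space; a two-sided derivative is also
  a one-sided one.\<close>

lemma (in real_domain) dmulti_unit_eq:
  assumes "smooth F" "y \<in> cube s"
  shows "dmulti {0..1} s \<nu> F y = dmulti UNIV s \<nu> F y"
proof -
  interpret C: product_domain "{0..1}" s by (rule product_domain_unit)
  have C_dom: "C.dom \<subseteq> dom" by (rule PiE_mono) simp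
  have "C.der js F y = der js F y" if "set js \<subseteq> {..<s}" for js
    using that assms(1)
  proof (induction js arbitrary: F)
    case (Cons j js)
    have "C.partial_deriv j F (dpartial UNIV j F)"
      using smooth_partial_deriv[OF Cons.prems(2), of j] Cons.prems(1) C_dom
      unfolding partial_deriv_def C.partial_deriv_def
      by (auto intro: has_field_derivative_at_within)
    then have "C.der (j # js) F y = C.der js (dpartial UNIV j F) y"
      using Cons.prems(1) assms(2) by (intro C.der_Cons_eq) (auto simp: cube_def)
    also have "\<dots> = der js (dpartial UNIV j F) y"
      using Cons.prems by (intro Cons.IH smooth_dpartial) auto
    finally show ?case by simp
  qed simp
  then show ?thesis
    using set_dlist[of s \<nu>] by (simp add: dmulti_def diter_eq_der C.diter_eq_der)
qed

section \<open>Multi-indices as sorted lists, and the values of the majorants\<close>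

lemma rev_dlist: "rev (dlist s \<nu>) = concat (map (\<lambda>j. replicate (\<nu> j) j) (rev [0..<s]))"
  by (simp add: dlist_def rev_concat rev_map comp_def)

text \<open>A subsequence of a sorted list is sorted, hence comes from a multi-index again. So
  bounds on the derivatives \<open>dmulti\<close> alone suffice for the Leibniz rule.\<close>

lemma subseq_concat_replicate:
  assumes "distinct xs" "subseq l (concat (map (\<lambda>j. replicate (\<nu> j) j) xs))"
  shows "\<exists>\<mu>. l = concat (map (\<lambda>j. replicate (\<mu> j) j) xs)"
  using assms
proof (induction xs arbitrary: l)
  case (Cons j xs)
  then obtain l1 l2 where l: "l = l1 @ l2" "subseq l1 (replicate (\<nu> j) j)"
    "subseq l2 (concat (map (\<lambda>j. replicate (\<nu> j) j) xs))"
    by (auto elim: subseq_appendE)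
  obtain \<mu> where \<mu>: "l2 = concat (map (\<lambda>j. replicate (\<mu> j) j) xs)"
    using Cons.IH[OF _ l(3)] Cons.prems(1) by auto
  have "x = j" if "x \<in> set l1" for x
    using list_emb_set[OF l(2) that] by auto
  then have l1: "l1 = replicate (length l1) j" by (simp add: replicate_length_same)
  have "map (\<lambda>i. replicate ((\<mu>(j := length l1)) i) i) xs = map (\<lambda>i. replicate (\<mu> i) i) xs"
    using Cons.prems(1) by (intro map_cong) auto
  then have "concat (map (\<lambda>i. replicate ((\<mu>(j := length l1)) i) i) (j # xs)) = replicate (length l1) j @ l2"
    by (simp only: list.map concat.simps fun_upd_same \<mu>)
  then have "l = concat (map (\<lambda>i. replicate ((\<mu>(j := length l1)) i) i) (j # xs))"
    using l(1) l1 by metis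
  then show ?case by blast
qed simp

lemma subseq_rev_dlist: "subseq l (rev (dlist s \<nu>)) \<Longrightarrow> \<exists>\<mu>. l = rev (dlist s \<mu>)"
  unfolding rev_dlist by (rule subseq_concat_replicate) auto

lemma length_dlist: "length (dlist s \<nu>) = mabs s \<nu>"
  by (simp add: dlist_def mabs_def length_concat comp_def interv_sum_list_conv_sum_set_nat lessThan_atLeast0)

lemma maj_0_dlist:
  "maj b 0 (rev (dlist s \<nu>)) f k = fact (mabs s \<nu>) * bpow s b \<nu> * fps_nth f (mabs s \<nu>)"
  unfolding maj_0 by (simp add: rev_map[symmetric] prod_list_dlist bpow_def length_dlist)

lemma maj_dlist:
  "maj (\<lambda>j. c * b j) c (rev (dlist s \<nu>)) f (\<lambda>_. 0) = c ^ mabs s \<nu> *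
    (\<Sum>m\<in>PiE {..<s} (\<lambda>j. {0..\<nu> j}). stirling_multi s \<nu> m * bpow s b m * (fact (mabs s m) * fps_nth f (mabs s m)))"
proof -
  have "maj (\<lambda>j. c * b j) (c * 1) (rev (dlist s \<nu>)) f (\<lambda>_. 0)
      = c ^ mabs s \<nu> * maj b 1 (rev (dlist s \<nu>)) f (\<lambda>_. 0)"
    by (simp only: maj_scale length_rev length_dlist)
  also have "maj b 1 (rev (dlist s \<nu>)) f (\<lambda>_. 0) = (\<Sum>m\<in>PiE {..<s} (\<lambda>j. {0..\<nu> j}).
      stirling_multi s \<nu> m * bpow s b m * (fact (mabs s m) * fps_nth f (mabs s m)))"
    unfolding rev_dlist
    by (subst maj_Stirling) (simp_all add: stirling_multi_def bpow_def mabs_def lessThan_atLeast0)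
  finally show ?thesis by simp
qed

text \<open>The derivative at 0, of order \<alpha> in each variable of \<open>u\<close>, of
  \<open>f (\<Sum>j. b_j (exp x_j - 1))\<close>. The series is left general to cover both
  \<open>geo 1\<close> and \<open>geo 1 ^ 2\<close>.\<close>

definition stirling_sum :: "(nat \<Rightarrow> real) \<Rightarrow> nat \<Rightarrow> real fps \<Rightarrow> nat set \<Rightarrow> real" where
  "stirling_sum b \<alpha> f u = (\<Sum>m\<in>PiE u (\<lambda>_. {0..\<alpha>}). (\<Prod>j\<in>u. real (Stirling \<alpha> (m j)))
    * (\<Prod>j\<in>u. b j ^ m j) * (fact (\<Sum>j\<in>u. m j) * fps_nth f (\<Sum>j\<in>u. m j)))"

lemma mabs_alpha_u:
  assumes "u \<subseteq> {..<s}"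
  shows "mabs s (alpha_u \<alpha> u) = \<alpha> * card u"
proof -
  have "mabs s (alpha_u \<alpha> u) = (\<Sum>j\<in>u. \<alpha>)"
    unfolding mabs_def alpha_u_def using assms by (intro sum.mono_neutral_cong_right) auto
  then show ?thesis by simp
qed

lemma maj_alpha_u:
  assumes "u \<subseteq> {..<s}"
  shows "maj (\<lambda>j. c * b j) c (rev (dlist s (alpha_u \<alpha> u))) f (\<lambda>_. 0)
    = c ^ (\<alpha> * card u) * stirling_sum b \<alpha> f u"
proof -
  let ?us = "rev (filter (\<lambda>j. j \<in> u) [0..<s])"
  have set_us: "set ?us = u" using assms by auto
  have js: "rev (dlist s (alpha_u \<alpha> u)) = concat (map (\<lambda>j. replicate \<alpha> j) ?us)"
    by (simp add: dlist_alpha_u[OF assms] rev_concat rev_map comp_def)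
  have "maj (\<lambda>j. c * b j) (c * 1) (rev (dlist s (alpha_u \<alpha> u))) f (\<lambda>_. 0)
      = c ^ (\<alpha> * card u) * maj b 1 (rev (dlist s (alpha_u \<alpha> u))) f (\<lambda>_. 0)"
    by (simp only: maj_scale length_rev length_dlist mabs_alpha_u[OF assms])
  also have "maj b 1 (rev (dlist s (alpha_u \<alpha> u))) f (\<lambda>_. 0) = stirling_sum b \<alpha> f u"
    unfolding js by (subst maj_Stirling) (simp_all only: set_us stirling_sum_def, simp_all)
  finally show ?thesis by simp
qed

lemma stirling_sum_geo:
  "stirling_sum b \<alpha> (geo 1) u = (\<Sum>m\<in>PiE u (\<lambda>_. {0..\<alpha>}). fact (\<Sum>j\<in>u. m j)
    * (\<Prod>j\<in>u. real (Stirling \<alpha> (m j))) * (\<Prod>j\<in>u. b j ^ m j))"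
  unfolding stirling_sum_def by (intro sum.cong refl) (simp add: mult_ac)

text \<open>The coefficient \<open>n + 1\<close> of \<open>geo 1 ^ 2\<close> raises the factorial of
  \<open>n\<close> to that of \<open>n + 1\<close>: this is the source of the shifted factorials in
  the bounds on the squared error.\<close>

lemma stirling_sum_geo_square:
  "stirling_sum b \<alpha> (geo 1 ^ 2) u = (\<Sum>m\<in>PiE u (\<lambda>_. {0..\<alpha>}). fact ((\<Sum>j\<in>u. m j) + 1)
    * (\<Prod>j\<in>u. real (Stirling \<alpha> (m j))) * (\<Prod>j\<in>u. b j ^ m j))"
  unfolding stirling_sum_def geo_square_nth by (intro sum.cong refl) (simp add: algebra_simps)

lemma maj_per_bound:
  "maj (\<lambda>j. c * b j) c (rev (dlist s \<nu>)) (geo 1) (\<lambda>_. 0) = c ^ mabs s \<nu> * per_bound s b \<nu>"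
  unfolding maj_dlist per_bound_def by (simp add: mult_ac)

text \<open>The triangle inequality gives the difference the majorant \<open>2 * C\<close> times
  \<open>geo 1\<close>, and the Leibniz rule squares it. The hypotheses cover all sorted lists,
  hence every subsequence that the Leibniz rule produces.\<close>

lemma (in product_domain) abs_der_square_diff_le:
  assumes "smooth F" "smooth G" "y \<in> dom"
    and "\<And>\<nu>. \<bar>der (rev (dlist s \<nu>)) F y\<bar> \<le> C * maj b w (rev (dlist s \<nu>)) (geo 1) (\<lambda>_. 0)"
    and "\<And>\<nu>. \<bar>der (rev (dlist s \<nu>)) G y\<bar> \<le> C * maj b w (rev (dlist s \<nu>)) (geo 1) (\<lambda>_. 0)"
  shows "\<bar>der (rev (dlist s \<nu>)) (\<lambda>y. (F y - G y)^2) y\<bar>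
    \<le> (4 * C^2) * maj b w (rev (dlist s \<nu>)) (geo 1 ^ 2) (\<lambda>_. 0)"
proof -
  define H where "H = (\<lambda>y. F y + (-1) * G y)"
  define g where "g = fps_const (2 * C) * geo 1"
  have smH: "smooth H" unfolding H_def using assms by (intro smooth_add smooth_cmult)
  have set: "set (rev (dlist s \<mu>)) \<subseteq> {..<s}" for \<mu>
    using set_dlist[of s \<mu>] by simp
  have H: "\<bar>der l H y\<bar> \<le> maj b w l g (\<lambda>_. 0)" if l: "subseq l (rev (dlist s \<nu>))" for l
  proof -
    obtain \<mu> where \<mu>: "l = rev (dlist s \<mu>)" using subseq_rev_dlist[OF l] by blast
    have "der l H y = der l F y + (-1) * der l G y"
      unfolding H_def using assms set[of \<mu>]
      by (simp only: \<mu> der_add smooth_cmult der_cmult)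
    then have "\<bar>der l H y\<bar> \<le> \<bar>der l F y\<bar> + \<bar>der l G y\<bar>" by simp
    also have "\<dots> \<le> maj b w l g (\<lambda>_. 0)"
      using assms(4)[of \<mu>] assms(5)[of \<mu>] unfolding g_def maj_cmult \<mu> by linarith
    finally show ?thesis .
  qed
  have "\<bar>der (rev (dlist s \<nu>)) (\<lambda>y. H y * H y) y\<bar>
      \<le> shuf (\<lambda>l. maj b w l g (\<lambda>_. 0)) (\<lambda>l. maj b w l g (\<lambda>_. 0)) (rev (dlist s \<nu>))"
    by (rule abs_der_mult_le[OF smH smH set assms(3) H H])
  also have "\<dots> = maj b w (rev (dlist s \<nu>)) (fps_const (4 * C^2) * geo 1 ^ 2) (\<lambda>_. 0)"
  proof -
    have "fps_const (4 * C^2) = fps_const (2 * C) * fps_const (2 * C)"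
      by (simp add: power2_eq_square)
    then have "g * g = fps_const (4 * C^2) * geo 1 ^ 2"
      unfolding g_def by (simp only: power2_eq_square mult_ac)
    then show ?thesis by (simp add: shuf_maj)
  qed
  also have "(\<lambda>y. H y * H y) = (\<lambda>y. (F y - G y)^2)"
    by (simp add: H_def power2_eq_square)
  finally show ?thesis unfolding maj_cmult .
qed

text \<open>The target and the network use \<open>K = C\<close> and \<open>f = geo 1\<close>, their
  squared difference \<open>K = 4 * C^2\<close> and \<open>f = geo 1 ^ 2\<close>.\<close>

lemma (in real_domain) periodic_norms_le:
  assumes F: "smooth F" and K: "K \<ge> 0" and \<gamma>: "\<And>u. u \<subseteq> {..<s} \<Longrightarrow> \<gamma> u > 0"
    and bound: "\<And>\<nu> y. y \<in> cube s \<Longrightarrow> \<bar>der (rev (dlist s \<nu>)) F y\<bar>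
      \<le> K * maj (\<lambda>j. 2 * pi * b j) (2 * pi) (rev (dlist s \<nu>)) f (\<lambda>_. 0)"
  shows "sob_sq s \<alpha> \<gamma> F \<le> K^2 * (\<Sum>u\<in>Pow {..<s}. (2 * pi) ^ (2 * \<alpha> * card u) / \<gamma> u * (stirling_sum b \<alpha> f u)^2)"
    and "periodic F \<Longrightarrow>
      korobov_norm s \<alpha> \<gamma> F \<le> K * Max ((\<lambda>u. (2 * pi) ^ (\<alpha> * card u) / \<gamma> u * stirling_sum b \<alpha> f u) ` Pow {..<s})"
proof -
  define B where "B u = K * ((2 * pi) ^ (\<alpha> * card u) * stirling_sum b \<alpha> f u)" for u
  have B: "\<bar>dmulti UNIV s (alpha_u \<alpha> u) F y\<bar> \<le> B u" if "u \<subseteq> {..<s}" "y \<in> cube s" for u y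
    using bound[OF that(2), of "alpha_u \<alpha> u"] unfolding maj_alpha_u[OF that(1)]
    by (simp add: dmulti_def diter_eq_der B_def)
  have "sob_sq s \<alpha> \<gamma> F \<le> (\<Sum>u\<in>Pow {..<s}. (1 / \<gamma> u) * (B u)^2)"
    using B by (intro sob_sq_le \<gamma>) (auto simp: dmulti_unit_eq[OF F])
  also have "\<dots> = K^2 * (\<Sum>u\<in>Pow {..<s}. (2 * pi) ^ (2 * \<alpha> * card u) / \<gamma> u * (stirling_sum b \<alpha> f u)^2)"
    unfolding sum_distrib_left
  proof (intro sum.cong refl)
    fix u
    have "(B u)^2 = K^2 * ((2 * pi) ^ (2 * \<alpha> * card u) * (stirling_sum b \<alpha> f u)^2)"
      unfolding B_def power_mult_distrib power_mult[symmetric] by (simp add: mult_ac power_mult_distrib)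
    then show "1 / \<gamma> u * (B u)^2 = K^2 * ((2 * pi) ^ (2 * \<alpha> * card u) / \<gamma> u * (stirling_sum b \<alpha> f u)^2)"
      by simp
  qed
  finally show "sob_sq s \<alpha> \<gamma> F \<le> K^2 * (\<Sum>u\<in>Pow {..<s}. (2 * pi) ^ (2 * \<alpha> * card u) / \<gamma> u * (stirling_sum b \<alpha> f u)^2)" .
  assume per: "periodic F"
  show "korobov_norm s \<alpha> \<gamma> F \<le> K * Max ((\<lambda>u. (2 * pi) ^ (\<alpha> * card u) / \<gamma> u * stirling_sum b \<alpha> f u) ` Pow {..<s})"
  proof (rule korobov_norm_le[OF F per _ B \<gamma>])
    fix \<nu> l assume "subseq l (rev (dlist s \<nu>))"
    then obtain \<mu> where "l = rev (dlist s \<mu>)" using subseq_rev_dlist by blast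
    then show "\<exists>B. \<forall>y\<in>cube s. \<bar>der l F y\<bar> \<le> B" using bound by blast
  next
    fix u assume u: "u \<subseteq> {..<s}"
    have "B u / \<gamma> u = K * ((2 * pi) ^ (\<alpha> * card u) / \<gamma> u * stirling_sum b \<alpha> f u)"
      by (simp add: B_def)
    also have "\<dots> \<le> K * Max ((\<lambda>u. (2 * pi) ^ (\<alpha> * card u) / \<gamma> u * stirling_sum b \<alpha> f u) ` Pow {..<s})"
      using u K by (intro mult_left_mono Max_ge) auto
    finally show "B u / \<gamma> u \<le> \<dots>" .
  qed
qed

lemma prod_alpha_u:
  assumes "u \<subseteq> {..<s}"
  shows "bpow s b (alpha_u 1 u) = (\<Prod>j\<in>u. b j)"
  unfolding bpow_def alpha_u_def using assms by (intro prod.mono_neutral_cong_right) auto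

lemma unit_sob_sq_le:
  assumes \<gamma>: "\<And>u. u \<subseteq> {..<s} \<Longrightarrow> \<gamma> u > 0"
    and bound: "\<And>\<nu> y. y \<in> cube s \<Longrightarrow> \<bar>dmulti {0..1} s \<nu> F y\<bar>
      \<le> K * maj b 0 (rev (dlist s \<nu>)) f (\<lambda>_. 0)"
  shows "sob_sq s 1 \<gamma> F \<le> K^2 * (\<Sum>u\<in>Pow {..<s}. (1 / \<gamma> u) * (fact (card u) * fps_nth f (card u) * (\<Prod>j\<in>u. b j))^2)"
proof -
  define B where "B u = K * (fact (card u) * fps_nth f (card u) * (\<Prod>j\<in>u. b j))" for u
  have "sob_sq s 1 \<gamma> F \<le> (\<Sum>u\<in>Pow {..<s}. (1 / \<gamma> u) * (B u)^2)"
  proof (rule sob_sq_le[OF _ \<gamma>])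
    fix u y assume u: "u \<subseteq> {..<s}" and "y \<in> cube s"
    then show "\<bar>dmulti {0..1} s (alpha_u 1 u) F y\<bar> \<le> B u"
      using bound[of y "alpha_u 1 u"] unfolding maj_0_dlist mabs_alpha_u[OF u] prod_alpha_u[OF u]
      by (simp add: B_def mult_ac)
  qed
  then show ?thesis unfolding B_def power_mult_distrib[of K] sum_distrib_left by (simp add: mult_ac)
qed

section \<open>Boundedness and periodicity of the network\<close>

lemma net_bounded:
  assumes "\<And>x. isCont \<sigma> x" "\<And>t. t \<in> {0..1} \<Longrightarrow> \<bar>inp t\<bar> \<le> 1" "d 0 = s"
  shows "\<exists>B. \<forall>y\<in>cube s. \<bar>net \<sigma> W v d inp l y p\<bar> \<le> B"
proof (induction l arbitrary: p)
  case 0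
  have "\<bar>net \<sigma> W v d inp 0 y p\<bar> \<le> (\<Sum>j<d 0. \<bar>W 0 p j\<bar> * 1) + \<bar>v 0 p\<bar>" if "y \<in> cube s" for y
  proof -
    have "\<bar>\<Sum>j<d 0. W 0 p j * inp (y j)\<bar> \<le> (\<Sum>j<d 0. \<bar>W 0 p j\<bar> * 1)"
    proof (rule order_trans[OF sum_abs sum_mono])
      fix j assume "j \<in> {..<d 0}"
      then have "y j \<in> {0..1}" using that assms(3) PiE_mem[of y "{..<s}" "\<lambda>_. {0..1}" j] by (simp add: cube_def)
      then show "\<bar>W 0 p j * inp (y j)\<bar> \<le> \<bar>W 0 p j\<bar> * 1"
        unfolding abs_mult by (intro mult_left_mono assms(2)) auto
    qed
    then show ?thesis unfolding net.simps by linarith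
  qed
  then show ?case by blast
next
  case (Suc l)
  have "\<exists>K. \<forall>y\<in>cube s. \<bar>\<sigma> (net \<sigma> W v d inp l y q)\<bar> \<le> K" for q
  proof -
    obtain B where B: "\<And>y. y \<in> cube s \<Longrightarrow> \<bar>net \<sigma> W v d inp l y q\<bar> \<le> B" using Suc by blast
    \<comment> \<open>The assumptions bound only the derivatives of \<open>\<sigma>\<close>; its own
      values are bounded by continuity on the compact range of the previous layer.\<close>
    have "compact (\<sigma> ` {-B..B})"
      using assms(1) by (intro compact_continuous_image continuous_at_imp_continuous_on) auto
    then have "bounded (\<sigma> ` {-B..B})" by (rule compact_imp_bounded)
    then obtain K where "\<forall>x\<in>{-B..B}. \<bar>\<sigma> x\<bar> \<le> K" unfolding bounded_iff by auto
    then have K: "\<And>x. x \<in> {-B..B} \<Longrightarrow> \<bar>\<sigma> x\<bar> \<le> K" by blast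
    have "\<bar>\<sigma> (net \<sigma> W v d inp l y q)\<bar> \<le> K" if "y \<in> cube s" for y
      using B[OF that] by (intro K) (simp add: abs_le_iff)
    then show ?thesis by blast
  qed
  then obtain K where K: "\<And>q y. y \<in> cube s \<Longrightarrow> \<bar>\<sigma> (net \<sigma> W v d inp l y q)\<bar> \<le> K q" by metis
  have "\<bar>net \<sigma> W v d inp (Suc l) y p\<bar> \<le> (\<Sum>q<d (Suc l). \<bar>W (Suc l) p q\<bar> * K q) + \<bar>v (Suc l) p\<bar>"
    if "y \<in> cube s" for y
  proof -
    have "\<bar>\<Sum>q<d (Suc l). W (Suc l) p q * \<sigma> (net \<sigma> W v d inp l y q)\<bar> \<le> (\<Sum>q<d (Suc l). \<bar>W (Suc l) p q\<bar> * K q)"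
    proof (rule order_trans[OF sum_abs sum_mono])
      fix q
      show "\<bar>W (Suc l) p q * \<sigma> (net \<sigma> W v d inp l y q)\<bar> \<le> \<bar>W (Suc l) p q\<bar> * K q"
        unfolding abs_mult by (intro mult_left_mono K that) auto
    qed
    then show ?thesis unfolding net.simps by linarith
  qed
  then show ?case by blast
qed

text \<open>A real \<open>SUP\<close> dominates the members of a set only if the set is bounded
  above, which \<open>net_bounded\<close> guarantees.\<close>

lemma abs_net_le_net_sup:
  assumes "\<And>x. isCont \<sigma> x" "\<And>t. t \<in> {0..1} \<Longrightarrow> \<bar>inp t\<bar> \<le> 1" "d 0 = s" "y \<in> cube s" "p < n"
  shows "\<bar>net \<sigma> W v d inp L y p\<bar> \<le> net_sup s n (net \<sigma> W v d inp L)"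
proof -
  let ?m = "\<lambda>y. Max ((\<lambda>p. \<bar>net \<sigma> W v d inp L y p\<bar>) ` {..<n})"
  obtain B where B: "\<And>p y. y \<in> cube s \<Longrightarrow> \<bar>net \<sigma> W v d inp L y p\<bar> \<le> B p"
    using net_bounded[of \<sigma> inp d s W v L] assms(1-3) by metis
  have "?m y \<le> Max (B ` {..<n})" if "y \<in> cube s" for y
  proof (rule Max.boundedI)
    fix a assume "a \<in> (\<lambda>p. \<bar>net \<sigma> W v d inp L y p\<bar>) ` {..<n}"
    then obtain q where q: "q < n" "a = \<bar>net \<sigma> W v d inp L y q\<bar>" by auto
    then have "a \<le> B q" using B[OF that] by simp
    also have "\<dots> \<le> Max (B ` {..<n})" using q by (intro Max_ge) auto
    finally show "a \<le> Max (B ` {..<n})" .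
  qed (use assms(5) in auto)
  then have bdd: "bdd_above (?m ` cube s)" by (auto intro!: bdd_aboveI)
  have "\<bar>net \<sigma> W v d inp L y p\<bar> \<le> ?m y" using assms(5) by (intro Max_ge) auto
  also have "\<dots> \<le> net_sup s n (net \<sigma> W v d inp L)"
    unfolding net_sup_def by (rule cSUP_upper[OF assms(4) bdd])
  finally show ?thesis .
qed

lemma net_periodic:
  assumes "\<And>t. inp (t + 1) = inp t"
  shows "net \<sigma> W v d inp l (y(j := y j + 1)) = net \<sigma> W v d inp l y"
proof (induction l)
  case 0
  have "inp ((y(j := y j + 1)) i) = inp (y i)" for i using assms by simp
  then show ?case by (simp only: net.simps)
next
  case (Suc l)
  then show ?case by (simp only: net.simps)
qed

text \<open>The products \<open>Pk\<close> with \<open>k < L\<close> involve just R_1, ..., R_{L-1},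
  the numbers bounded by \<rho>, so S_L is at most \<tau> times a geometric sum.\<close>

lemma SL_le:
  assumes "\<xi> > 0" "\<tau> > 0" "\<rho> > 0" "\<forall>l\<in>{1..L}. R l > 0" "\<forall>l\<in>{1..L-1}. R l \<le> \<rho>"
  shows "if \<xi> * \<tau> * \<rho> = 1 then SL \<xi> \<tau> R L \<le> \<tau> * real L
    else SL \<xi> \<tau> R L \<le> \<tau> * (((\<xi> * \<tau> * \<rho>) ^ L - 1) / (\<xi> * \<tau> * \<rho> - 1))"
proof -
  define x where "x = \<xi> * \<tau> * \<rho>"
  have "Pk \<xi> \<tau> R k \<le> x ^ k" if "k < L" for k
  proof -
    have "Pk \<xi> \<tau> R k \<le> (\<Prod>t\<in>{1..k}. x)"
      unfolding Pk_def x_def using assms that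
      by (intro prod_mono conjI mult_nonneg_nonneg mult_left_mono) (auto intro: less_imp_le)
    then show ?thesis by simp
  qed
  then have "SL \<xi> \<tau> R L \<le> \<tau> * (\<Sum>k<L. x ^ k)"
    unfolding SL_def using assms(2) by (intro mult_left_mono sum_mono) auto
  also have "(\<Sum>k<L. x ^ k) = (if x = 1 then real L else (x ^ L - 1) / (x - 1))"
    using geometric_sum[of x L] by simp
  finally show ?thesis unfolding x_def by (simp split: if_splits)
qed

section \<open>The two networks and the final estimates\<close>

theorem theorem3p2:
  fixes s L Nobs :: nat and d :: "nat \<Rightarrow> nat"
    and W :: "nat \<Rightarrow> nat \<Rightarrow> nat \<Rightarrow> real" and v :: "nat \<Rightarrow> nat \<Rightarrow> real"
    and \<sigma> :: "real \<Rightarrow> real" and \<xi> \<tau> \<rho> C :: real and R b :: "nat \<Rightarrow> real"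
    and \<gamma> :: "nat set \<Rightarrow> real"
  assumes s_pos: "s \<ge> 1" and L_pos: "L \<ge> 1"
    and d0: "d 0 = s" and dL: "d (Suc L) = Nobs" and d_pos: "\<forall>l\<le>Suc L. d l \<ge> 1"
    and \<sigma>_smooth: "\<forall>n x. ((deriv ^^ n) \<sigma> has_real_derivative (deriv ^^ Suc n) \<sigma> x) (at x)"
    and \<sigma>_bound: "\<forall>n\<ge>1. \<forall>x. \<bar>(deriv ^^ n) \<sigma> x\<bar> \<le> \<xi> * \<tau> ^ n * fact n"
    and \<xi>_pos: "\<xi> > 0" and \<tau>_pos: "\<tau> > 0"
    and R_pos: "\<forall>l\<in>{1..L}. R l > 0"
    and W_norm: "\<forall>l\<in>{1..L}. mat_inf_norm W d l \<le> R l"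
    and \<rho>_pos: "\<rho> > 0" and R_\<rho>: "\<forall>l\<in>{1..L-1}. R l \<le> \<rho>"
    and b_pos: "\<forall>j. b j > 0" and C_pos: "C > 0"
    and \<beta>_bound: "\<forall>j<s. beta W d j \<le> b j / SL \<xi> \<tau> R L"
    and \<gamma>_pos: "\<forall>u\<subseteq>{..<s}. \<gamma> u > 0" and \<gamma>_empty: "\<gamma> {} = 1"
  shows
   "(if \<xi> * \<tau> * \<rho> = 1 then SL \<xi> \<tau> R L \<le> \<tau> * real L
     else SL \<xi> \<tau> R L \<le> \<tau> * (((\<xi> * \<tau> * \<rho>) ^ L - 1) / (\<xi> * \<tau> * \<rho> - 1)))
    \<and>
    (\<forall>G :: (nat \<Rightarrow> real) \<Rightarrow> nat \<Rightarrow> real.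
       max (net_sup s Nobs (net \<sigma> W v d (\<lambda>t. t) L)) (Pk \<xi> \<tau> R L / SL \<xi> \<tau> R L) \<le> C \<longrightarrow>
       (\<forall>p<Nobs. smooth_on {0..1} s (\<lambda>y. G y p)) \<longrightarrow>
       (\<forall>\<nu> :: nat \<Rightarrow> nat. \<forall>y\<in>cube s. \<forall>p<Nobs.
          \<bar>dmulti {0..1} s \<nu> (\<lambda>y. G y p) y\<bar> \<le> C * fact (mabs s \<nu>) * bpow s b \<nu>) \<longrightarrow>
       (\<forall>\<nu> :: nat \<Rightarrow> nat. \<forall>y\<in>cube s. \<forall>p<Nobs.
          \<bar>dmulti {0..1} s \<nu> (\<lambda>y. net \<sigma> W v d (\<lambda>t. t) L y p) y\<bar>
            \<le> C * fact (mabs s \<nu>) * bpow s b \<nu>)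
       \<and> (\<forall>p<Nobs.
          max (sob_sq s 1 \<gamma> (\<lambda>y. G y p)) (sob_sq s 1 \<gamma> (\<lambda>y. net \<sigma> W v d (\<lambda>t. t) L y p))
            \<le> C^2 * (\<Sum>u\<in>Pow {..<s}. (1 / \<gamma> u) * (fact (card u) * (\<Prod>j\<in>u. b j))^2)
          \<and> sob_sq s 1 \<gamma> (\<lambda>y. (G y p - net \<sigma> W v d (\<lambda>t. t) L y p)^2)
            \<le> 16 * C^4 * (\<Sum>u\<in>Pow {..<s}. (1 / \<gamma> u) * (fact (card u + 1) * (\<Prod>j\<in>u. b j))^2)))
    \<and>
    (\<forall>G :: (nat \<Rightarrow> real) \<Rightarrow> nat \<Rightarrow> real.
       max (net_sup s Nobs (net \<sigma> W v d (\<lambda>t. sin (2 * pi * t)) L)) (Pk \<xi> \<tau> R L / SL \<xi> \<tau> R L) \<le> C \<longrightarrow>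
       (\<forall>p<Nobs. smooth_on UNIV s (\<lambda>y. G y p)) \<longrightarrow>
       (\<forall>y\<in>real_space s. \<forall>j<s. \<forall>p<Nobs. G (y(j := y j + 1)) p = G y p) \<longrightarrow>
       (\<forall>\<nu> :: nat \<Rightarrow> nat. \<forall>y\<in>cube s. \<forall>p<Nobs.
          \<bar>dmulti UNIV s \<nu> (\<lambda>y. G y p) y\<bar> \<le> C * (2 * pi) ^ mabs s \<nu> * per_bound s b \<nu>) \<longrightarrow>
       (\<forall>\<nu> :: nat \<Rightarrow> nat. \<forall>y\<in>cube s. \<forall>p<Nobs.
          \<bar>dmulti UNIV s \<nu> (\<lambda>y. net \<sigma> W v d (\<lambda>t. sin (2 * pi * t)) L y p) y\<bar>
            \<le> C * (2 * pi) ^ mabs s \<nu> * per_bound s b \<nu>)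
       \<and> (\<forall>\<alpha>::nat. \<alpha> \<ge> 1 \<longrightarrow> (\<forall>p<Nobs.
          max (sob_sq s \<alpha> \<gamma> (\<lambda>y. G y p))
              (sob_sq s \<alpha> \<gamma> (\<lambda>y. net \<sigma> W v d (\<lambda>t. sin (2 * pi * t)) L y p))
            \<le> C^2 * (\<Sum>u\<in>Pow {..<s}. (2 * pi) ^ (2 * \<alpha> * card u) / \<gamma> u *
                 (\<Sum>m\<in>PiE u (\<lambda>_. {0..\<alpha>}). fact (\<Sum>j\<in>u. m j)
                    * (\<Prod>j\<in>u. real (Stirling \<alpha> (m j))) * (\<Prod>j\<in>u. b j ^ m j))^2)
          \<and> sob_sq s \<alpha> \<gamma> (\<lambda>y. (G y p - net \<sigma> W v d (\<lambda>t. sin (2 * pi * t)) L y p)^2)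
            \<le> 16 * C^4 * (\<Sum>u\<in>Pow {..<s}. (2 * pi) ^ (2 * \<alpha> * card u) / \<gamma> u *
                 (\<Sum>m\<in>PiE u (\<lambda>_. {0..\<alpha>}). fact ((\<Sum>j\<in>u. m j) + 1)
                    * (\<Prod>j\<in>u. real (Stirling \<alpha> (m j))) * (\<Prod>j\<in>u. b j ^ m j))^2)))
       \<and> (\<forall>\<alpha>::nat. \<alpha> \<ge> 2 \<longrightarrow> (\<forall>p<Nobs.
          max (korobov_norm s \<alpha> \<gamma> (\<lambda>y. G y p))
              (korobov_norm s \<alpha> \<gamma> (\<lambda>y. net \<sigma> W v d (\<lambda>t. sin (2 * pi * t)) L y p))
            \<le> C * Max ((\<lambda>u. (2 * pi) ^ (\<alpha> * card u) / \<gamma> u *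
                 (\<Sum>m\<in>PiE u (\<lambda>_. {0..\<alpha>}). fact (\<Sum>j\<in>u. m j)
                    * (\<Prod>j\<in>u. real (Stirling \<alpha> (m j))) * (\<Prod>j\<in>u. b j ^ m j))) ` Pow {..<s})
          \<and> korobov_norm s \<alpha> \<gamma> (\<lambda>y. (G y p - net \<sigma> W v d (\<lambda>t. sin (2 * pi * t)) L y p)^2)
            \<le> 4 * C^2 * Max ((\<lambda>u. (2 * pi) ^ (\<alpha> * card u) / \<gamma> u *
                 (\<Sum>m\<in>PiE u (\<lambda>_. {0..\<alpha>}). fact ((\<Sum>j\<in>u. m j) + 1)
                    * (\<Prod>j\<in>u. real (Stirling \<alpha> (m j))) * (\<Prod>j\<in>u. b j ^ m j))) ` Pow {..<s}))))"
proof -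
  define h where "h n = (deriv ^^ n) \<sigma>" for n
  \<comment> \<open>With this scale the series of the last layer has its pole at 1, and the
    assumption on \<open>beta\<close> reads
    \<open>\<bar>W 0 p j\<bar> \<le> c * b j\<close>.\<close>
  define c where "c = 1 / SL \<xi> \<tau> R L"
  have P_pos: "Pk \<xi> \<tau> R k > 0" if "k \<le> L" for k
    unfolding Pk_def using \<xi>_pos \<tau>_pos R_pos that by (intro prod_pos) auto
  have S_pos: "SL \<xi> \<tau> R L > 0"
    unfolding SL_def using \<tau>_pos L_pos P_pos
    by (intro mult_pos_pos sum_pos) (auto simp: lessThan_empty_iff)
  have c_pos: "c > 0" using S_pos by (simp add: c_def)
  have h: "(h n has_real_derivative h (Suc n) x) (at x)" "n \<ge> 1 \<Longrightarrow> \<bar>h n x\<bar> \<le> \<xi> * \<tau> ^ n * fact n" for n x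
    unfolding h_def using \<sigma>_smooth \<sigma>_bound by blast+
  have h0: "h 0 = \<sigma>" by (simp add: h_def)
  have \<sigma>_cont: "isCont \<sigma> x" for x using DERIV_isCont[OF h(1)[of 0]] by (simp add: h0)
  have W0: "\<bar>W 0 p j\<bar> \<le> c * b j" if "p < d 1" "j < s" for p j
  proof -
    have "\<bar>W 0 p j\<bar> \<le> beta W d j" unfolding beta_def using that by (intro Max_ge) auto
    also have "\<dots> \<le> c * b j" using \<beta>_bound that by (simp add: c_def)
    finally show ?thesis .
  qed
  have Wl: "(\<Sum>q<d l. \<bar>W l p q\<bar>) \<le> R l" if "1 \<le> l" "l \<le> L" "p < d (Suc l)" for l p
  proof -
    have "(\<Sum>q<d l. \<bar>W l p q\<bar>) \<le> mat_inf_norm W d l"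
      unfolding mat_inf_norm_def using that by (intro Max_ge) auto
    also have "\<dots> \<le> R l" using W_norm that by simp
    finally show ?thesis .
  qed
  define ua where "ua n t = (if n = 0 then t else if n = 1 then 1 else 0 :: real)" for n :: nat and t
  \<comment> \<open>For the identity \<open>w = 0\<close>: as \<open>0 ^ 0 = 1\<close>, the required
    bound allows a first derivative of size 1 and forces all higher ones to vanish.\<close>
  interpret A: bounded_network "{0..1}" s \<sigma> "\<lambda>t. t" h ua W v d \<xi> \<tau> c 1 0 R b L
  proof (intro bounded_network.intro product_domain_unit bounded_network_axioms.intro)
    fix n :: nat and x :: real
    show "(ua n has_real_derivative ua (Suc n) x) (at x)"
      by (cases "n = 0") (auto simp: ua_def[abs_def])
    show "\<bar>ua (Suc n) x\<bar> \<le> 1 * 0 ^ n" by (simp add: ua_def)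
  qed (use d0 h h0 \<xi>_pos \<tau>_pos c_pos b_pos R_pos W0 Wl in \<open>auto simp: ua_def[abs_def]\<close>)
  \<comment> \<open>Each derivative of the sine advances its phase by a quarter period, which gives
    all derivatives by one formula.\<close>
  define ub where "ub n t = (2 * pi) ^ n * sin (2 * pi * t + real n * (pi / 2))" for n :: nat and t
  interpret B: bounded_network UNIV s \<sigma> "\<lambda>t. sin (2 * pi * t)" h ub W v d \<xi> \<tau> c "2 * pi" "2 * pi" R b L
  proof (intro bounded_network.intro bounded_network_axioms.intro)
    show "product_domain (UNIV :: real set)" by unfold_locales simp
    fix n :: nat and x :: real
    have shift: "sin (2 * pi * x + real (Suc n) * (pi / 2)) = cos (2 * pi * x + real n * (pi / 2))"
      using sin_add[of "2 * pi * x + real n * (pi / 2)" "pi / 2"]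
      by (simp add: algebra_simps add_divide_distrib)
    show "(ub n has_real_derivative ub (Suc n) x) (at x)"
      unfolding ub_def[abs_def] shift by (auto intro!: derivative_eq_intros)
    have "(2 * pi) ^ Suc n * \<bar>sin (2 * pi * x + real (Suc n) * (pi / 2))\<bar> \<le> (2 * pi) ^ Suc n * 1"
      by (intro mult_left_mono abs_sin_le_one) simp
    then show "\<bar>ub (Suc n) x\<bar> \<le> 2 * pi * (2 * pi) ^ n" by (simp add: ub_def abs_mult)
  qed (use d0 h h0 \<xi>_pos \<tau>_pos c_pos b_pos R_pos W0 Wl in \<open>auto simp: ub_def[abs_def]\<close>)
  \<comment> \<open>\<open>B\<close> and \<open>D\<close> extend the same
    \<open>product_domain\<close> over \<open>UNIV\<close>, so smoothness and derivative bounds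
    obtained in \<open>B\<close> can be fed to the norm estimates of \<open>D\<close>.\<close>
  interpret D: real_domain s .
  have cube_dom: "y \<in> B.dom" if "y \<in> cube s" for y
    using that D.cube_subset_dom by blast
  have js: "set (rev (dlist s \<nu>)) \<subseteq> {..<s}" for \<nu>
    using set_dlist by simp
  show ?thesis
  proof (intro conjI allI impI ballI)
    show "if \<xi> * \<tau> * \<rho> = 1 then SL \<xi> \<tau> R L \<le> \<tau> * real L
     else SL \<xi> \<tau> R L \<le> \<tau> * (((\<xi> * \<tau> * \<rho>) ^ L - 1) / (\<xi> * \<tau> * \<rho> - 1))"
      using SL_le[OF \<xi>_pos \<tau>_pos \<rho>_pos R_pos R_\<rho>] .
  next
    fix G :: "(nat \<Rightarrow> real) \<Rightarrow> nat \<Rightarrow> real"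
    let ?N = "net \<sigma> W v d (\<lambda>t. t) L"
    assume sup: "max (net_sup s Nobs ?N) (Pk \<xi> \<tau> R L / SL \<xi> \<tau> R L) \<le> C"
      and smG: "\<forall>p<Nobs. smooth_on {0..1} s (\<lambda>y. G y p)"
      and G_le: "\<forall>\<nu>. \<forall>y\<in>cube s. \<forall>p<Nobs.
          \<bar>dmulti {0..1} s \<nu> (\<lambda>y. G y p) y\<bar> \<le> C * fact (mabs s \<nu>) * bpow s b \<nu>"
    have NC: "\<bar>?N y p\<bar> \<le> C" if "y \<in> cube s" "p < Nobs" for y p
      using abs_net_le_net_sup[of \<sigma> "\<lambda>t. t" d s y p Nobs W v L, OF \<sigma>_cont _ d0 that] sup by simp
    have N_maj: "\<bar>dmulti {0..1} s \<nu> (\<lambda>y. ?N y p) y\<bar> \<le> C * maj b 0 (rev (dlist s \<nu>)) (geo 1) (\<lambda>_. 0)"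
      if "y \<in> cube s" "p < Nobs" for \<nu> y p
      using A.abs_der_net_le[OF c_def S_pos, of p "rev (dlist s \<nu>)" y C] NC[OF that] that js sup dL
      unfolding dmulti_def A.diter_eq_der mult_1_left cube_def by simp
    have G_maj: "\<bar>dmulti {0..1} s \<nu> (\<lambda>y. G y p) y\<bar> \<le> C * maj b 0 (rev (dlist s \<nu>)) (geo 1) (\<lambda>_. 0)"
      if "y \<in> cube s" "p < Nobs" for \<nu> y p
      using G_le that by (simp add: maj_0_dlist mult.assoc)
    have sq_maj: "\<bar>dmulti {0..1} s \<nu> (\<lambda>y. (G y p - ?N y p)^2) y\<bar>
        \<le> (4 * C^2) * maj b 0 (rev (dlist s \<nu>)) (geo 1 ^ 2) (\<lambda>_. 0)"
      if "y \<in> cube s" "p < Nobs" for \<nu> y p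
      unfolding dmulti_def A.diter_eq_der
    proof (rule A.abs_der_square_diff_le)
      show "A.smooth (\<lambda>y. G y p)" using smG that A.smooth_on_imp_smooth by blast
      show "A.smooth (\<lambda>y. ?N y p)" by (rule A.smooth_net)
      show "y \<in> A.dom" using that by (simp add: cube_def)
    qed (use G_maj[OF that] N_maj[OF that] in \<open>auto simp: dmulti_def A.diter_eq_der\<close>)
    show "\<bar>dmulti {0..1} s \<nu> (\<lambda>y. ?N y p) y\<bar> \<le> C * fact (mabs s \<nu>) * bpow s b \<nu>"
      if "y \<in> cube s" "p < Nobs" for \<nu> y p
      using N_maj[OF that] by (simp add: maj_0_dlist mult.assoc)
    show "max (sob_sq s 1 \<gamma> (\<lambda>y. G y p)) (sob_sq s 1 \<gamma> (\<lambda>y. ?N y p))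
        \<le> C^2 * (\<Sum>u\<in>Pow {..<s}. (1 / \<gamma> u) * (fact (card u) * (\<Prod>j\<in>u. b j))^2)" if "p < Nobs" for p
      using unit_sob_sq_le[of s \<gamma> "\<lambda>y. G y p" C b "geo 1"] unit_sob_sq_le[of s \<gamma> "\<lambda>y. ?N y p" C b "geo 1"]
        \<gamma>_pos G_maj[OF _ that] N_maj[OF _ that] by simp
    have fact_Suc_card: "fact (card u) * fps_nth (geo 1 ^ 2) (card u) = (fact (card u + 1) :: real)" for u :: "nat set"
      unfolding geo_square_nth by (simp add: algebra_simps)
    show "sob_sq s 1 \<gamma> (\<lambda>y. (G y p - ?N y p)^2)
        \<le> 16 * C^4 * (\<Sum>u\<in>Pow {..<s}. (1 / \<gamma> u) * (fact (card u + 1) * (\<Prod>j\<in>u. b j))^2)" if "p < Nobs" for p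
    proof -
      have "sob_sq s 1 \<gamma> (\<lambda>y. (G y p - ?N y p)^2) \<le> (4 * C^2)^2 *
          (\<Sum>u\<in>Pow {..<s}. (1 / \<gamma> u) * (fact (card u) * fps_nth (geo 1 ^ 2) (card u) * (\<Prod>j\<in>u. b j))^2)"
        using \<gamma>_pos sq_maj[OF _ that] by (intro unit_sob_sq_le) auto
      then show ?thesis unfolding fact_Suc_card by (simp add: power_mult_distrib flip: power_mult)
    qed
  next
    fix G :: "(nat \<Rightarrow> real) \<Rightarrow> nat \<Rightarrow> real"
    let ?N = "net \<sigma> W v d (\<lambda>t. sin (2 * pi * t)) L"
    assume sup: "max (net_sup s Nobs ?N) (Pk \<xi> \<tau> R L / SL \<xi> \<tau> R L) \<le> C"
      and smG: "\<forall>p<Nobs. smooth_on UNIV s (\<lambda>y. G y p)"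
      and perG: "\<forall>y\<in>real_space s. \<forall>j<s. \<forall>p<Nobs. G (y(j := y j + 1)) p = G y p"
      and G_le: "\<forall>\<nu>. \<forall>y\<in>cube s. \<forall>p<Nobs.
          \<bar>dmulti UNIV s \<nu> (\<lambda>y. G y p) y\<bar> \<le> C * (2 * pi) ^ mabs s \<nu> * per_bound s b \<nu>"
    have NC: "\<bar>?N y p\<bar> \<le> C" if "y \<in> cube s" "p < Nobs" for y p
      using abs_net_le_net_sup[of \<sigma> "\<lambda>t. sin (2 * pi * t)" d s y p Nobs W v L, OF \<sigma>_cont _ d0 that] sup by simp
    have smG': "B.smooth (\<lambda>y. G y p)" if "p < Nobs" for p
      using smG that B.smooth_on_imp_smooth by blast
    have smN: "B.smooth (\<lambda>y. ?N y p)" for p by (rule B.smooth_net)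
    have smSq: "B.smooth (\<lambda>y. (G y p - ?N y p)^2)" if "p < Nobs" for p
    proof -
      have "B.smooth (\<lambda>y. (G y p + (-1) * ?N y p) * (G y p + (-1) * ?N y p))"
        by (intro B.smooth_mult B.smooth_add B.smooth_cmult smG'[OF that] smN)
      then show ?thesis by (simp add: power2_eq_square)
    qed
    have perG': "D.periodic (\<lambda>y. G y p)" if "p < Nobs" for p
      using perG that unfolding D.periodic_def real_space_def by blast
    have "sin (2 * pi * (t + 1)) = sin (2 * pi * t)" for t :: real
      using sin_periodic[of "2 * pi * t"] by (simp add: algebra_simps)
    then have perN: "?N (y(j := y j + 1)) = ?N y" for y j
      by (rule net_periodic)
    have perN': "D.periodic (\<lambda>y. ?N y p)" for p
      unfolding D.periodic_def perN by simp
    have perSq: "D.periodic (\<lambda>y. (G y p - ?N y p)^2)" if "p < Nobs" for p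
      using perG'[OF that] unfolding D.periodic_def perN by simp
    have N_maj: "\<bar>B.der (rev (dlist s \<nu>)) (\<lambda>y. ?N y p) y\<bar>
        \<le> C * maj (\<lambda>j. 2 * pi * b j) (2 * pi) (rev (dlist s \<nu>)) (geo 1) (\<lambda>_. 0)"
      if "y \<in> cube s" "p < Nobs" for \<nu> y p
      using that cube_dom NC sup dL by (intro B.abs_der_net_le[OF c_def S_pos] js) auto
    have G_maj: "\<bar>B.der (rev (dlist s \<nu>)) (\<lambda>y. G y p) y\<bar>
        \<le> C * maj (\<lambda>j. 2 * pi * b j) (2 * pi) (rev (dlist s \<nu>)) (geo 1) (\<lambda>_. 0)"
      if "y \<in> cube s" "p < Nobs" for \<nu> y p
      using G_le that unfolding maj_per_bound dmulti_def B.diter_eq_der by (simp add: mult.assoc)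
    have sq_maj: "\<bar>B.der (rev (dlist s \<nu>)) (\<lambda>y. (G y p - ?N y p)^2) y\<bar>
        \<le> (4 * C^2) * maj (\<lambda>j. 2 * pi * b j) (2 * pi) (rev (dlist s \<nu>)) (geo 1 ^ 2) (\<lambda>_. 0)"
      if "y \<in> cube s" "p < Nobs" for \<nu> y p
      by (rule B.abs_der_square_diff_le[OF smG'[OF that(2)] smN cube_dom[OF that(1)] G_maj[OF that] N_maj[OF that]])
    have C0: "C \<ge> 0" "4 * C^2 \<ge> 0" using C_pos by simp_all
    have \<gamma>: "\<gamma> u > 0" if "u \<subseteq> {..<s}" for u using \<gamma>_pos that by blast
    note G_norms = D.periodic_norms_le[OF smG' C0(1) \<gamma> G_maj, unfolded stirling_sum_geo]
    note N_norms = D.periodic_norms_le[OF smN C0(1) \<gamma> N_maj, unfolded stirling_sum_geo]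
    note sq_norms = D.periodic_norms_le[OF smSq C0(2) \<gamma> sq_maj, unfolded stirling_sum_geo_square]
    show "\<bar>dmulti UNIV s \<nu> (\<lambda>y. ?N y p) y\<bar> \<le> C * (2 * pi) ^ mabs s \<nu> * per_bound s b \<nu>"
      if "y \<in> cube s" "p < Nobs" for \<nu> y p
      using N_maj[OF that] unfolding maj_per_bound dmulti_def B.diter_eq_der by (simp add: mult.assoc)
    show "max (sob_sq s \<alpha> \<gamma> (\<lambda>y. G y p)) (sob_sq s \<alpha> \<gamma> (\<lambda>y. ?N y p))
        \<le> C^2 * (\<Sum>u\<in>Pow {..<s}. (2 * pi) ^ (2 * \<alpha> * card u) / \<gamma> u *
             (\<Sum>m\<in>PiE u (\<lambda>_. {0..\<alpha>}). fact (\<Sum>j\<in>u. m j)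
                * (\<Prod>j\<in>u. real (Stirling \<alpha> (m j))) * (\<Prod>j\<in>u. b j ^ m j))^2)" if "p < Nobs" for \<alpha> p
      by (rule max.boundedI[OF G_norms(1) N_norms(1)]) (use that in auto)
    have C4: "16 * C^4 = (4 * C^2)^2" by (simp add: power_mult_distrib flip: power_mult)
    show "sob_sq s \<alpha> \<gamma> (\<lambda>y. (G y p - ?N y p)^2)
        \<le> 16 * C^4 * (\<Sum>u\<in>Pow {..<s}. (2 * pi) ^ (2 * \<alpha> * card u) / \<gamma> u *
             (\<Sum>m\<in>PiE u (\<lambda>_. {0..\<alpha>}). fact ((\<Sum>j\<in>u. m j) + 1)
                * (\<Prod>j\<in>u. real (Stirling \<alpha> (m j))) * (\<Prod>j\<in>u. b j ^ m j))^2)" if "p < Nobs" for \<alpha> p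
      unfolding C4 by (rule sq_norms(1)) (use that in auto)
    show "max (korobov_norm s \<alpha> \<gamma> (\<lambda>y. G y p)) (korobov_norm s \<alpha> \<gamma> (\<lambda>y. ?N y p))
        \<le> C * Max ((\<lambda>u. (2 * pi) ^ (\<alpha> * card u) / \<gamma> u *
             (\<Sum>m\<in>PiE u (\<lambda>_. {0..\<alpha>}). fact (\<Sum>j\<in>u. m j)
                * (\<Prod>j\<in>u. real (Stirling \<alpha> (m j))) * (\<Prod>j\<in>u. b j ^ m j))) ` Pow {..<s})" if "p < Nobs" for \<alpha> p
      by (rule max.boundedI[OF G_norms(2) N_norms(2)]) (use that perG' perN' in auto)
    show "korobov_norm s \<alpha> \<gamma> (\<lambda>y. (G y p - ?N y p)^2)
        \<le> 4 * C^2 * Max ((\<lambda>u. (2 * pi) ^ (\<alpha> * card u) / \<gamma> u *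
             (\<Sum>m\<in>PiE u (\<lambda>_. {0..\<alpha>}). fact ((\<Sum>j\<in>u. m j) + 1)
                * (\<Prod>j\<in>u. real (Stirling \<alpha> (m j))) * (\<Prod>j\<in>u. b j ^ m j))) ` Pow {..<s})" if "p < Nobs" for \<alpha> p
      by (rule sq_norms(2)) (use that perSq in auto)
  qed
qed

end
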